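(* Let $n\ge2$ and $p_1,\dots,p_{n-1}\ge1$ be integers and let $\eta\in\mathbb{C}$. In the algebra $\tilde B_{p_1,\dots,p_{n-1}}(\eta)$ define, for $u\in\mathbb{C}$, $$ \begin{aligned} \tilde T(u)=\sum_{\substack{1\le\alpha_1\le p_1\\ \cdots\\ 1\le\alpha_{n-1}\le p_{n-1}}} &\frac{\theta(u-z_{\alpha_1,1})\,\Big(\prod_{\gamma=1}^{n-2}\theta(u+z_{\alpha_\gamma,\gamma}-z_{\alpha_{\gamma+1},\gamma+1})\Big)\,\theta(u+z_{\alpha_{n-1},n-1})}{\prod_{\gamma=1}^{n-1}\ \prod_{1\le\beta\le p_\gamma,\ \beta\ne\alpha_\gamma}\theta(z_{\alpha_\gamma,\gamma}-z_{\beta,\gamma})}\\ &\times\prod_{\gamma=1}^{n-2}\theta\big(z_{\alpha_\gamma,\gamma}+z_{\alpha_{\gamma+1},\gamma+1}-t_{\gamma,\gamma+1}\big)\; e_{\alpha_1,1}\cdots e_{\alpha_{n-1},n-1}\,f_{1,2}f_{2,3}\cdots f_{n-2,n-1}. \end{aligned} $$ Then $$[\tilde T(u),\tilde T(v)]=0\qquad\text{for all }u,v\in\mathbb{C}.$$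
   Context: Let $\Gamma=\mathbb{Z}\oplus\tau\mathbb{Z}$ with $\operatorname{Im}\tau>0$. $\theta$ is a fixed nonzero holomorphic theta function of order 1: $\theta(z+1)=\theta(z)$, $\theta(z+\tau)=\theta(-z)=-e^{-2\pi i z}\theta(z)$, $\theta(0)=0$. $\tilde B_{p_1,\dots,p_{n-1}}(\eta)$ is the associative algebra with generators $z_{\alpha,\gamma},e_{\alpha,\gamma}$ ($1\le\gamma\le n-1$, $1\le\alpha\le p_\gamma$) and $t_{\gamma,\gamma+1},f_{\gamma,\gamma+1}$ ($1\le\gamma\le n-2$), with relations $$e_{\alpha,\gamma}z_{\beta,\gamma}=(z_{\beta,\gamma}-n\eta)e_{\alpha,\gamma}\quad(\alpha\ne\beta),\qquad f_{\gamma,\gamma+1}t_{\gamma,\gamma+1}=(t_{\gamma,\gamma+1}-n\eta)f_{\gamma,\gamma+1},$$ all other pairs of generators commuting (in particular $e_{\alpha,\gamma}$ commutes with $z_{\alpha,\gamma}$). As for the other Weyl-like algebras here, meromorphic functions of the commuting variables $z_{\alpha,\gamma},t_{\gamma,\gamma+1}$ are allowed as coefficients: elements are linear combinations of products of such a function with a monomial in the $e_{\alpha,\gamma},f_{\gamma,\gamma+1}$, and moving $e_{\alpha,\gamma}$ (resp. $f_{\gamma,\gamma+1}$) to the right past a function shifts $z_{\beta,\gamma}\mapsto z_{\beta,\gamma}-n\eta$ for all $\beta\ne\alpha$ (resp. $t_{\gamma,\gamma+1}\mapsto t_{\gamma,\gamma+1}-n\eta$). For $n=2$ there are no generators $t,f$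 and the corresponding products are empty. *)

theory Defs
  imports "HOL-Complex_Analysis.Complex_Analysis" "HOL-Library.Poly_Mapping" "HOL-Algebra.Ring"
begin

section \<open>Generic functions and meromorphic functions of several variables\<close>

text \<open>
  A point assigns a complex number to every variable in \<open>'i\<close>; the topology on
  \<open>'i \<Rightarrow> complex\<close> is the product topology. For a finite set \<open>V\<close> of variables,
  functions on \<open>\<complex>\<^sup>V\<close> are represented by the functions of points that only depend
  on the coordinates in \<open>V\<close>.
\<close>

definition dense_set :: "'a::topological_space set \<Rightarrow> bool" where
  "dense_set D \<longleftrightarrow> closure D = UNIV"

definition depends_on :: "'i set \<Rightarrow> (('i \<Rightarrow> complex) \<Rightarrow> complex) \<Rightarrow> bool" where
  "depends_on V f \<longleftrightarrow> (\<forall>x y. (\<forall>i\<in>V. x i = y i) \<longrightarrow> f x = f y)"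

text \<open>Used for open \<open>U\<close> only: continuous and holomorphic in each variable separately.\<close>

definition holomorphic_multi :: "('i \<Rightarrow> complex) set \<Rightarrow> (('i \<Rightarrow> complex) \<Rightarrow> complex) \<Rightarrow> bool" where
  "holomorphic_multi U g \<longleftrightarrow> continuous_on U g \<and>
     (\<forall>x\<in>U. \<forall>i. (\<lambda>w. g (x(i := w))) field_differentiable (at (x i)))"

text \<open>
  \<open>f\<close> is on \<open>U\<close> a quotient of two holomorphic functions, the denominator vanishing on no
  nonempty open subset. The value of \<open>f\<close> at the zeros of the denominator is irrelevant.
\<close>

definition quotient_on ::
    "'i set \<Rightarrow> (('i \<Rightarrow> complex) \<Rightarrow> complex) \<Rightarrow> ('i \<Rightarrow> complex) set \<Rightarrow>
     (('i \<Rightarrow> complex) \<Rightarrow> complex) \<Rightarrow> (('i \<Rightarrow> complex) \<Rightarrow> complex) \<Rightarrow> bool" where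
  "quotient_on V f U g h \<longleftrightarrow> depends_on V g \<and> depends_on V h \<and>
     holomorphic_multi U g \<and> holomorphic_multi U h \<and>
     U \<subseteq> closure {x \<in> U. h x \<noteq> 0} \<and>
     (\<forall>x\<in>U. h x \<noteq> 0 \<longrightarrow> f x = g x / h x)"

definition meromorphic_multi :: "'i set \<Rightarrow> (('i \<Rightarrow> complex) \<Rightarrow> complex) \<Rightarrow> bool" where
  "meromorphic_multi V f \<longleftrightarrow> depends_on V f \<and>
     (\<forall>a. \<exists>U g h. open U \<and> a \<in> U \<and> quotient_on V f U g h)"

lemma meromorphic_multiE:
  assumes "meromorphic_multi V f"
  obtains U g h where "open U" "a \<in> U" "quotient_on V f U g h"
  using assms unfolding meromorphic_multi_def by blast

lemma quotient_onD:
  assumes "quotient_on V f U g h"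
  shows "depends_on V g" "depends_on V h" "holomorphic_multi U g" "holomorphic_multi U h"
    "U \<subseteq> closure {x \<in> U. h x \<noteq> 0}" "x \<in> U \<Longrightarrow> h x \<noteq> 0 \<Longrightarrow> f x = g x / h x"
  using assms unfolding quotient_on_def by blast+

lemma meromorphic_multiI:
  assumes "depends_on V f"
    and "\<And>a. \<exists>U g h. open U \<and> a \<in> U \<and> quotient_on V f U g h"
  shows "meromorphic_multi V f"
  using assms unfolding meromorphic_multi_def by blast

lemma dense_set_iff: "dense_set D \<longleftrightarrow> (\<forall>U. open U \<longrightarrow> U \<noteq> {} \<longrightarrow> U \<inter> D \<noteq> {})"
proof -
  have "dense_set D \<longleftrightarrow> (\<forall>x. x \<in> closure D)"
    unfolding dense_set_def by auto
  also have "\<dots> \<longleftrightarrow> (\<forall>U. open U \<longrightarrow> U \<noteq> {} \<longrightarrow> U \<inter> D \<noteq> {})"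
    unfolding closure_iff_nhds_not_empty by blast
  finally show ?thesis .
qed

lemma dense_set_UNIV: "dense_set UNIV"
  by (simp add: dense_set_def)

lemma dense_set_Int:
  assumes "open A" "dense_set A" "dense_set B"
  shows "dense_set (A \<inter> B)"
  unfolding dense_set_iff
proof (intro allI impI)
  fix U :: "'a set" assume U: "open U" "U \<noteq> {}"
  then have "open (U \<inter> A)" "U \<inter> A \<noteq> {}"
    using assms by (auto simp: dense_set_iff)
  then show "U \<inter> (A \<inter> B) \<noteq> {}"
    using assms(3) unfolding dense_set_iff by (metis inf_assoc)
qed

definition generic_eq :: "(('i \<Rightarrow> complex) \<Rightarrow> complex) \<Rightarrow> (('i \<Rightarrow> complex) \<Rightarrow> complex) \<Rightarrow> bool" where
  "generic_eq f g \<longleftrightarrow> (\<exists>D. open D \<and> dense_set D \<and> (\<forall>x\<in>D. f x = g x))"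

lemma generic_eq_refl: "generic_eq f f"
  unfolding generic_eq_def using dense_set_UNIV by blast

lemma generic_eq_sym: "generic_eq f g \<Longrightarrow> generic_eq g f"
  unfolding generic_eq_def by metis

lemma generic_eq_trans: "generic_eq f g \<Longrightarrow> generic_eq g h \<Longrightarrow> generic_eq f h"
  unfolding generic_eq_def using dense_set_Int by (metis IntD1 IntD2 open_Int)

lemma generic_eq_binop:
  assumes "generic_eq f f'" "generic_eq g g'"
  shows "generic_eq (\<lambda>x. F (f x) (g x)) (\<lambda>x. F (f' x) (g' x))"
proof -
  obtain D D' where "open D" "dense_set D" "\<forall>x\<in>D. f x = f' x"
    "open D'" "dense_set D'" "\<forall>x\<in>D'. g x = g' x"
    using assms unfolding generic_eq_def by blast
  then have "open (D \<inter> D')" "dense_set (D \<inter> D')"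
      "\<forall>x\<in>D \<inter> D'. F (f x) (g x) = F (f' x) (g' x)"
    by (auto simp: dense_set_Int)
  then show ?thesis unfolding generic_eq_def by blast
qed

lemma continuous_on_translate: "continuous_on UNIV (\<lambda>(x :: 'i \<Rightarrow> complex) i. x i - c i)"
  by (intro continuous_on_coordinatewise_then_product continuous_intros)
     (rule continuous_on_product_coordinates)

lemma open_translate:
  fixes D :: "('i \<Rightarrow> complex) set"
  shows "open D \<Longrightarrow> open ((\<lambda>x i. x i - c i) -` D)"
  using continuous_on_translate[of c] by (simp add: continuous_on_open_vimage)

lemma dense_set_translate:
  fixes D :: "('i \<Rightarrow> complex) set"
  assumes "dense_set D"
  shows "dense_set ((\<lambda>x i. x i - c i) -` D)"
  unfolding dense_set_iff
proof (intro allI impI)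
  fix U :: "('i \<Rightarrow> complex) set" assume U: "open U" "U \<noteq> {}"
  let ?U = "(\<lambda>x i. x i - (- c i)) -` U"
  obtain u where "u \<in> U" using U by blast
  then have "(\<lambda>i. u i - c i) \<in> ?U" by simp
  moreover have "open ?U" using U(1) by (rule open_translate)
  ultimately obtain y where "y \<in> D" "(\<lambda>i. y i + c i) \<in> U"
    using assms unfolding dense_set_iff by fastforce
  then have "(\<lambda>i. y i + c i) \<in> U \<inter> (\<lambda>x i. x i - c i) -` D"
    by simp
  then show "U \<inter> (\<lambda>x i. x i - c i) -` D \<noteq> {}" by blast
qed

lemma generic_eq_translate:
  assumes "generic_eq f g"
  shows "generic_eq (\<lambda>x. f (\<lambda>i. x i - c i)) (\<lambda>x. g (\<lambda>i. x i - c i))"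
proof -
  obtain D where D: "open D" "dense_set D" "\<forall>x\<in>D. f x = g x"
    using assms unfolding generic_eq_def by blast
  let ?D = "(\<lambda>x i. x i - c i) -` D"
  have "open ?D" "dense_set ?D"
    using D by (auto intro: open_translate dense_set_translate)
  moreover have "\<forall>x\<in>?D. f (\<lambda>i. x i - c i) = g (\<lambda>i. x i - c i)" using D by simp
  ultimately show ?thesis unfolding generic_eq_def by blast
qed

text \<open>
  Functions up to equality on a dense open set. The meromorphic functions are
  carved out of this ring by \<open>Mero\<close> below.
\<close>

quotient_type 'i gfun = "('i \<Rightarrow> complex) \<Rightarrow> complex" / generic_eq
  by (rule equivpI)
     (auto intro!: reflpI sympI transpI
       intro: generic_eq_refl generic_eq_sym generic_eq_trans)

lift_definition gfun_of :: "(('i \<Rightarrow> complex) \<Rightarrow> complex) \<Rightarrow> 'i gfun" is "\<lambda>f. f" .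

instantiation gfun :: (type) comm_ring_1
begin

lift_definition zero_gfun :: "'a gfun" is "\<lambda>_. 0" .
lift_definition one_gfun :: "'a gfun" is "\<lambda>_. 1" .
lift_definition plus_gfun :: "'a gfun \<Rightarrow> 'a gfun \<Rightarrow> 'a gfun" is "\<lambda>f g x. f x + g x"
  by (rule generic_eq_binop)
lift_definition minus_gfun :: "'a gfun \<Rightarrow> 'a gfun \<Rightarrow> 'a gfun" is "\<lambda>f g x. f x - g x"
  by (rule generic_eq_binop)
lift_definition uminus_gfun :: "'a gfun \<Rightarrow> 'a gfun" is "\<lambda>f x. - f x"
  by (rule generic_eq_binop[where F = "\<lambda>a b. - a"])
lift_definition times_gfun :: "'a gfun \<Rightarrow> 'a gfun \<Rightarrow> 'a gfun" is "\<lambda>f g x. f x * g x"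
  by (rule generic_eq_binop)

instance
proof
  show "(0 :: 'a gfun) \<noteq> 1"
    by transfer (auto simp: generic_eq_def dense_set_def)
qed (transfer; simp add: algebra_simps generic_eq_refl)+

end

lift_definition translate :: "('i \<Rightarrow> complex) \<Rightarrow> 'i gfun \<Rightarrow> 'i gfun"
  is "\<lambda>c f x. f (\<lambda>i. x i - c i)"
  by (rule generic_eq_translate)

definition Mero :: "'i set \<Rightarrow> 'i gfun set" where
  "Mero V = gfun_of ` {f. meromorphic_multi V f}"

lemma translate_0 [simp]: "translate c 0 = 0"
  by transfer (simp add: generic_eq_refl)

lemma translate_1 [simp]: "translate c 1 = 1"
  by transfer (simp add: generic_eq_refl)

lemma translate_add: "translate c (f + g) = translate c f + translate c g"
  by transfer (simp add: generic_eq_refl)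

lemma translate_mult: "translate c (f * g) = translate c f * translate c g"
  by transfer (simp add: generic_eq_refl)

lemma translate_zero_vec [simp]: "translate (\<lambda>_. 0) f = f"
  by transfer (simp add: generic_eq_refl)

lemma translate_translate: "translate c (translate d f) = translate (\<lambda>i. c i + d i) f"
  by transfer (simp add: generic_eq_refl diff_diff_eq)

lemma holomorphic_multi_subset:
  "holomorphic_multi U g \<Longrightarrow> V \<subseteq> U \<Longrightarrow> holomorphic_multi V g"
  unfolding holomorphic_multi_def by (meson continuous_on_subset subsetD)

lemma holomorphic_multi_const: "holomorphic_multi U (\<lambda>_. c)"
  unfolding holomorphic_multi_def by simp

lemma holomorphic_multi_add:
  "holomorphic_multi U f \<Longrightarrow> holomorphic_multi U g \<Longrightarrow> holomorphic_multi U (\<lambda>x. f x + g x)"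
  unfolding holomorphic_multi_def by (auto intro!: continuous_intros field_differentiable_add)

lemma holomorphic_multi_mult:
  "holomorphic_multi U f \<Longrightarrow> holomorphic_multi U g \<Longrightarrow> holomorphic_multi U (\<lambda>x. f x * g x)"
  unfolding holomorphic_multi_def by (auto intro!: continuous_intros field_differentiable_mult)

lemma holomorphic_multi_translate:
  assumes "holomorphic_multi U f"
  shows "holomorphic_multi ((\<lambda>x i. x i - c i) -` U) (\<lambda>x. f (\<lambda>i. x i - c i))"
  unfolding holomorphic_multi_def
proof (intro conjI ballI allI)
  show "continuous_on ((\<lambda>x i. x i - c i) -` U) (\<lambda>x. f (\<lambda>i. x i - c i))"
    by (rule continuous_on_compose2[where g = f and t = U])
       (use assms continuous_on_subset[OF continuous_on_translate]
         in \<open>auto simp: holomorphic_multi_def\<close>)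
next
  fix x i assume x: "x \<in> (\<lambda>x i. x i - c i) -` U"
  define y where "y = (\<lambda>i. x i - c i)"
  have "(\<lambda>w. f (y(i := w))) field_differentiable (at (x i - c i))"
    using assms x unfolding holomorphic_multi_def y_def by auto
  then have "(\<lambda>w. f (y(i := w))) \<circ> (\<lambda>w. w - c i) field_differentiable (at (x i))"
    by (intro field_differentiable_compose derivative_intros) auto
  moreover have "(\<lambda>j. (x(i := w)) j - c j) = y(i := w - c i)" for w
    by (auto simp: y_def)
  ultimately show "(\<lambda>w. f (\<lambda>j. (x(i := w)) j - c j)) field_differentiable (at (x i))"
    by (simp add: o_def)
qed

lemma holomorphic_multi_open_nz:
  assumes "open U" "holomorphic_multi U h"
  shows "open {x \<in> U. h x \<noteq> 0}"
proof -
  have "open (h -` (- {0}) \<inter> U)"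
    using assms by (intro continuous_on_open_vimage[THEN iffD1, rule_format])
      (auto simp: holomorphic_multi_def)
  moreover have "h -` (- {0}) \<inter> U = {x \<in> U. h x \<noteq> 0}" by auto
  ultimately show ?thesis by simp
qed

lemma depends_on_binop:
  assumes "depends_on V f" "depends_on V g"
  shows "depends_on V (\<lambda>x. F (f x) (g x))"
  unfolding depends_on_def
proof (intro allI impI)
  fix x y :: "'a \<Rightarrow> complex" assume "\<forall>i\<in>V. x i = y i"
  then have "f x = f y" "g x = g y" using assms unfolding depends_on_def by blast+
  then show "F (f x) (g x) = F (f y) (g y)" by simp
qed

lemma meromorphic_multi_binop:
  fixes V :: "'i set"
  assumes f: "meromorphic_multi V f" and g: "meromorphic_multi V g"
    and F: "\<And>a b c d. b \<noteq> 0 \<Longrightarrow> d \<noteq> 0 \<Longrightarrow> F (a / b) (c / d) = G a b c d / (b * d)"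
    and G: "\<And>(U :: ('i \<Rightarrow> complex) set) a b c d. holomorphic_multi U a \<Longrightarrow> holomorphic_multi U b \<Longrightarrow>
      holomorphic_multi U c \<Longrightarrow> holomorphic_multi U d \<Longrightarrow>
      holomorphic_multi U (\<lambda>x. G (a x) (b x) (c x) (d x))"
  shows "meromorphic_multi V (\<lambda>x. F (f x) (g x))"
proof (rule meromorphic_multiI)
  show "depends_on V (\<lambda>x. F (f x) (g x))"
    using f g unfolding meromorphic_multi_def by (blast intro: depends_on_binop)
next
  fix p
  obtain U a b where U0: "open U" "p \<in> U" "quotient_on V f U a b"
    by (rule meromorphic_multiE[OF f, of "p"])
  note U = U0(1,2) quotient_onD[OF U0(3)]
  obtain W c d where W0: "open W" "p \<in> W" "quotient_on V g W c d"
    by (rule meromorphic_multiE[OF g, of "p"])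
  note W = W0(1,2) quotient_onD[OF W0(3)]
  have h: "holomorphic_multi (U \<inter> W) a" "holomorphic_multi (U \<inter> W) b"
    "holomorphic_multi (U \<inter> W) c" "holomorphic_multi (U \<inter> W) d"
    using U W by (auto intro: holomorphic_multi_subset)
  have dens: "U \<inter> W \<subseteq> closure {x \<in> U \<inter> W. b x * d x \<noteq> 0}"
  proof
    fix q assume q: "q \<in> U \<inter> W"
    show "q \<in> closure {x \<in> U \<inter> W. b x * d x \<noteq> 0}"
      unfolding closure_iff_nhds_not_empty
    proof (intro allI impI)
      fix A S assume A: "S \<subseteq> A" "q \<in> S" "open S"
      have q1: "q \<in> closure {x \<in> U. b x \<noteq> 0}" using q U by blast
      have "open (S \<inter> U \<inter> W)" "q \<in> S \<inter> U \<inter> W" using A U W q by auto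
      then obtain r where r: "r \<in> S \<inter> U \<inter> W" "b r \<noteq> 0"
        using q1 unfolding closure_iff_nhds_not_empty by blast
      have r1: "r \<in> closure {x \<in> W. d x \<noteq> 0}" using r W by blast
      have "open (S \<inter> W \<inter> {x \<in> U. b x \<noteq> 0})" 
        using A U W by (intro open_Int holomorphic_multi_open_nz)
      moreover have "r \<in> S \<inter> W \<inter> {x \<in> U. b x \<noteq> 0}" using r by blast
      ultimately obtain s where "s \<in> S \<inter> W \<inter> {x \<in> U. b x \<noteq> 0}" "d s \<noteq> 0"
        using r1 unfolding closure_iff_nhds_not_empty by blast
      then show "{x \<in> U \<inter> W. b x * d x \<noteq> 0} \<inter> A \<noteq> {}" using A by auto
    qed
  qed
  have "quotient_on V (\<lambda>x. F (f x) (g x)) (U \<inter> W)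
      (\<lambda>x. G (a x) (b x) (c x) (d x)) (\<lambda>x. b x * d x)"
    unfolding quotient_on_def
  proof (intro conjI)
    show "depends_on V (\<lambda>x. b x * d x)"
      using U(4) W(4) by (rule depends_on_binop)
    show "depends_on V (\<lambda>x. G (a x) (b x) (c x) (d x))"
      unfolding depends_on_def
    proof (intro allI impI)
      fix x y :: "'i \<Rightarrow> complex" assume "\<forall>i\<in>V. x i = y i"
      then have "a x = a y" "b x = b y" "c x = c y" "d x = d y"
        using U(3,4) W(3,4) unfolding depends_on_def by blast+
      then show "G (a x) (b x) (c x) (d x) = G (a y) (b y) (c y) (d y)" by simp
    qed
    show "holomorphic_multi (U \<inter> W) (\<lambda>x. G (a x) (b x) (c x) (d x))"
      by (rule G) (rule h)+
    show "holomorphic_multi (U \<inter> W) (\<lambda>x. b x * d x)"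
      by (intro holomorphic_multi_mult h)
    show "U \<inter> W \<subseteq> closure {x \<in> U \<inter> W. b x * d x \<noteq> 0}" by (rule dens)
    show "\<forall>x\<in>U \<inter> W. b x * d x \<noteq> 0 \<longrightarrow>
        F (f x) (g x) = G (a x) (b x) (c x) (d x) / (b x * d x)"
      using U(8) W(8) F by auto
  qed
  moreover have "open (U \<inter> W)" "p \<in> U \<inter> W" using U W by auto
  ultimately show "\<exists>U g' h. open U \<and> p \<in> U \<and> quotient_on V (\<lambda>x. F (f x) (g x)) U g' h"
    by blast
qed

lemma meromorphic_multi_quotient:
  assumes "depends_on V g" "depends_on V h" "holomorphic_multi UNIV g"
    "holomorphic_multi UNIV h" "dense_set {x. h x \<noteq> 0}"
  shows "meromorphic_multi V (\<lambda>x. g x / h x)"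
proof (rule meromorphic_multiI)
  show "depends_on V (\<lambda>x. g x / h x)" 
    using assms(1,2) by (rule depends_on_binop)
  fix a
  have "quotient_on V (\<lambda>x. g x / h x) UNIV g h"
    using assms unfolding quotient_on_def dense_set_def by simp
  then show "\<exists>U g' h'. open U \<and> a \<in> U \<and> quotient_on V (\<lambda>x. g x / h x) U g' h'"
    by blast
qed

lemma meromorphic_multi_const: "meromorphic_multi V (\<lambda>_. c)"
  using meromorphic_multi_quotient[of V "\<lambda>_. c" "\<lambda>_. 1"]
  by (simp add: depends_on_def holomorphic_multi_const dense_set_UNIV)

lemma meromorphic_multi_translate:
  assumes "meromorphic_multi V f"
  shows "meromorphic_multi V (\<lambda>x. f (\<lambda>i. x i - c i))"
proof (rule meromorphic_multiI)
  have dep: "depends_on V (\<lambda>x. k (\<lambda>i. x i - c i))" if "depends_on V k" for k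
    unfolding depends_on_def
  proof (intro allI impI)
    fix x y :: "'a \<Rightarrow> complex" assume "\<forall>i\<in>V. x i = y i"
    then have "\<forall>i\<in>V. x i - c i = y i - c i" by simp
    then show "k (\<lambda>i. x i - c i) = k (\<lambda>i. y i - c i)"
      using that[unfolded depends_on_def, rule_format, of "\<lambda>i. x i - c i" "\<lambda>i. y i - c i"]
      by simp
  qed
  have "depends_on V f" using assms unfolding meromorphic_multi_def by (rule conjunct1)
  then show "depends_on V (\<lambda>x. f (\<lambda>i. x i - c i))" by (rule dep)
  fix a
  obtain U g h where U0: "open U" "(\<lambda>i. a i - c i) \<in> U" "quotient_on V f U g h"
    by (rule meromorphic_multiE[OF assms, of "(\<lambda>i. a i - c i)"])
  note U = U0(1,2) quotient_onD[OF U0(3)]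
  let ?s = "\<lambda>x i. x i - c i"
  have "?s -` U \<subseteq> closure {x \<in> ?s -` U. h (?s x) \<noteq> 0}"
  proof
    fix q assume q: "q \<in> ?s -` U"
    show "q \<in> closure {x \<in> ?s -` U. h (?s x) \<noteq> 0}"
      unfolding closure_iff_nhds_not_empty
    proof (intro allI impI)
      fix A S assume A: "S \<subseteq> A" "q \<in> S" "open S"
      let ?S = "(\<lambda>x i. x i - (- c i)) -` S"
      have S1: "open ?S" using A(3) by (rule open_translate)
      have S2: "?s q \<in> ?S" using A(2) by simp
      have "?s q \<in> closure {x \<in> U. h x \<noteq> 0}"
        by (rule subsetD[OF U(7)]) (use q in simp)
      then have "\<forall>A V. V \<subseteq> A \<longrightarrow> open V \<longrightarrow> ?s q \<in> V \<longrightarrow> {x \<in> U. h x \<noteq> 0} \<inter> A \<noteq> {}"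
        unfolding closure_iff_nhds_not_empty .
      from this[rule_format, OF subset_refl S1 S2]
      have "{x \<in> U. h x \<noteq> 0} \<inter> ?S \<noteq> {}" .
      then obtain y where y: "y \<in> ?S" "y \<in> U" "h y \<noteq> 0"
        by blast
      then have "(\<lambda>i. y i + c i) \<in> {x \<in> ?s -` U. h (?s x) \<noteq> 0} \<inter> A"
        using A by auto
      then show "{x \<in> ?s -` U. h (?s x) \<noteq> 0} \<inter> A \<noteq> {}" by (metis emptyE)
    qed
  qed
  moreover have "\<forall>x\<in>?s -` U. h (?s x) \<noteq> 0 \<longrightarrow> f (?s x) = g (?s x) / h (?s x)"
    using U(8) by simp
  ultimately have "quotient_on V (\<lambda>x. f (?s x)) (?s -` U) (\<lambda>x. g (?s x)) (\<lambda>x. h (?s x))"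
    unfolding quotient_on_def
    by (intro conjI dep U(3,4) holomorphic_multi_translate U(5,6))
  moreover have "open (?s -` U)" using U(1) by (rule open_translate)
  moreover have "a \<in> ?s -` U" using U(2) by simp
  ultimately show "\<exists>U g h. open U \<and> a \<in> U \<and> quotient_on V (\<lambda>x. f (?s x)) U g h"
    by blast
qed

lemma gfun_of_in_Mero: "meromorphic_multi V f \<Longrightarrow> gfun_of f \<in> Mero V"
  unfolding Mero_def by blast

lemma Mero_0: "0 \<in> Mero V" and Mero_1: "1 \<in> Mero V"
proof -
  have "(0 :: 'a gfun) = gfun_of (\<lambda>_. 0)" "(1 :: 'a gfun) = gfun_of (\<lambda>_. 1)"
    by (transfer, simp add: generic_eq_refl)+
  then show "0 \<in> Mero V" "1 \<in> Mero V"
    using gfun_of_in_Mero[OF meromorphic_multi_const] by metis+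
qed

lemma Mero_add: 
  assumes "f \<in> Mero V" "g \<in> Mero V" shows "f + g \<in> Mero V"
proof -
  obtain a b where ab: "meromorphic_multi V a" "meromorphic_multi V b"
    "f = gfun_of a" "g = gfun_of b" using assms unfolding Mero_def by blast
  have "meromorphic_multi V (\<lambda>x. a x + b x)"
    by (rule meromorphic_multi_binop[OF ab(1,2), 
          where F = "(+)" and G = "\<lambda>a b c d. a * d + c * b"])
       (simp add: field_simps, intro holomorphic_multi_add holomorphic_multi_mult)
  moreover have "f + g = gfun_of (\<lambda>x. a x + b x)"
    unfolding ab by transfer (simp add: generic_eq_refl)
  ultimately show ?thesis by (simp add: gfun_of_in_Mero)
qed

lemma Mero_mult: 
  assumes "f \<in> Mero V" "g \<in> Mero V" shows "f * g \<in> Mero V"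
proof -
  obtain a b where ab: "meromorphic_multi V a" "meromorphic_multi V b"
    "f = gfun_of a" "g = gfun_of b" using assms unfolding Mero_def by blast
  have "meromorphic_multi V (\<lambda>x. a x * b x)"
    by (rule meromorphic_multi_binop[OF ab(1,2), 
          where F = "(*)" and G = "\<lambda>a b c d. a * c"])
       (simp, intro holomorphic_multi_mult)
  moreover have "f * g = gfun_of (\<lambda>x. a x * b x)"
    unfolding ab by transfer (simp add: generic_eq_refl)
  ultimately show ?thesis by (simp add: gfun_of_in_Mero)
qed

lemma Mero_translate: 
  assumes "f \<in> Mero V" shows "translate c f \<in> Mero V"
proof -
  obtain a where a: "meromorphic_multi V a" "f = gfun_of a"
    using assms unfolding Mero_def by blast
  have "translate c f = gfun_of (\<lambda>x. a (\<lambda>i. x i - c i))"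
    unfolding a by transfer (simp add: generic_eq_refl)
  then show ?thesis using a by (simp add: gfun_of_in_Mero meromorphic_multi_translate)
qed

lemma Mero_uminus: "f \<in> Mero V \<Longrightarrow> - f \<in> Mero V"
proof -
  assume f: "f \<in> Mero V"
  have "(- 1 :: 'a gfun) = gfun_of (\<lambda>_. - 1)"
    by (transfer, simp add: generic_eq_refl)
  then have "- 1 \<in> Mero V" by (simp add: gfun_of_in_Mero meromorphic_multi_const)
  then have "- 1 * f \<in> Mero V" using f by (rule Mero_mult)
  then show ?thesis by simp
qed

section \<open>The algebra\<close>

text \<open>
  \<open>zvar \<alpha> \<gamma>\<close> is \<open>z\<^bsub>\<alpha>,\<gamma>\<^esub>\<close>, \<open>tvar \<gamma>\<close> is \<open>t\<^bsub>\<gamma>,\<gamma>+1\<^esub>\<close>,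
  \<open>egen \<alpha> \<gamma>\<close> is \<open>e\<^bsub>\<alpha>,\<gamma>\<^esub>\<close>, \<open>fgen \<gamma>\<close> is \<open>f\<^bsub>\<gamma>,\<gamma>+1\<^esub>\<close>.
\<close>

datatype var = zvar nat nat | tvar nat
datatype gen = egen nat nat | fgen nat

definition vars :: "nat \<Rightarrow> (nat \<Rightarrow> nat) \<Rightarrow> var set" where
  "vars n p = {zvar \<alpha> \<gamma> | \<alpha> \<gamma>. \<gamma> \<in> {1..n - 1} \<and> \<alpha> \<in> {1..p \<gamma>}} \<union> {tvar \<gamma> | \<gamma>. \<gamma> \<in> {1..n - 2}}"

definition gens :: "nat \<Rightarrow> (nat \<Rightarrow> nat) \<Rightarrow> gen set" where
  "gens n p = {egen \<alpha> \<gamma> | \<alpha> \<gamma>. \<gamma> \<in> {1..n - 1} \<and> \<alpha> \<in> {1..p \<gamma>}} \<union> {fgen \<gamma> | \<gamma>. \<gamma> \<in> {1..n - 2}}"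

text \<open>
  Monomials in the (commuting) generators \<open>e, f\<close> are exponent vectors. Moving the
  monomial \<open>m\<close> to the right past a function \<open>\<phi>\<close> replaces each variable \<open>i\<close> in
  \<open>\<phi>\<close> by \<open>i - shift n p \<eta> m i\<close>.
\<close>

fun shift :: "nat \<Rightarrow> (nat \<Rightarrow> nat) \<Rightarrow> complex \<Rightarrow> (gen \<Rightarrow>\<^sub>0 nat) \<Rightarrow> var \<Rightarrow> complex" where
  "shift n p \<eta> m (zvar \<beta> \<gamma>) =
     of_nat (\<Sum>\<alpha>\<in>{1..p \<gamma>} - {\<beta>}. Poly_Mapping.lookup m (egen \<alpha> \<gamma>)) * (of_nat n * \<eta>)"
| "shift n p \<eta> m (tvar \<gamma>) = of_nat (Poly_Mapping.lookup m (fgen \<gamma>)) * (of_nat n * \<eta>)"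

text \<open>
  An element \<open>\<Sum>\<^sub>m \<phi>\<^sub>m m\<close>, with the coefficient functions on the left, is the finitely
  supported map \<open>m \<mapsto> \<phi>\<^sub>m\<close>.
\<close>

type_synonym balg = "(gen \<Rightarrow>\<^sub>0 nat) \<Rightarrow>\<^sub>0 var gfun"

definition Bmult :: "nat \<Rightarrow> (nat \<Rightarrow> nat) \<Rightarrow> complex \<Rightarrow> balg \<Rightarrow> balg \<Rightarrow> balg" where
  "Bmult n p \<eta> a b = (\<Sum>m\<in>Poly_Mapping.keys a. \<Sum>k\<in>Poly_Mapping.keys b.
     Poly_Mapping.single (m + k)
       (Poly_Mapping.lookup a m * translate (shift n p \<eta> m) (Poly_Mapping.lookup b k)))"

definition Btilde :: "nat \<Rightarrow> (nat \<Rightarrow> nat) \<Rightarrow> complex \<Rightarrow> balg ring" where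
  "Btilde n p \<eta> =
    \<lparr> carrier = {a. \<forall>m\<in>Poly_Mapping.keys a.
         Poly_Mapping.keys m \<subseteq> gens n p \<and> Poly_Mapping.lookup a m \<in> Mero (vars n p)},
      monoid.mult = Bmult n p \<eta>,
      one = 1,
      zero = 0,
      add = (+) \<rparr>"

lemma Bmult_superset:
  assumes "finite S" "Poly_Mapping.keys a \<subseteq> S" "finite T" "Poly_Mapping.keys b \<subseteq> T"
  shows "Bmult n p \<eta> a b = (\<Sum>m\<in>S. \<Sum>k\<in>T. Poly_Mapping.single (m + k)
       (Poly_Mapping.lookup a m * translate (shift n p \<eta> m) (Poly_Mapping.lookup b k)))"
proof -
  let ?g = "\<lambda>m k. Poly_Mapping.single (m + k)
       (Poly_Mapping.lookup a m * translate (shift n p \<eta> m) (Poly_Mapping.lookup b k))"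
  have "(\<Sum>k\<in>Poly_Mapping.keys b. ?g m k) = (\<Sum>k\<in>T. ?g m k)" for m
    using assms by (intro sum.mono_neutral_left) (auto simp: in_keys_iff)
  moreover have "(\<Sum>m\<in>Poly_Mapping.keys a. \<Sum>k\<in>T. ?g m k) = (\<Sum>m\<in>S. \<Sum>k\<in>T. ?g m k)"
    using assms by (intro sum.mono_neutral_left) (auto simp: in_keys_iff)
  ultimately show ?thesis unfolding Bmult_def by simp
qed

lemma Bmult_add_left: "Bmult n p \<eta> (a + b) c = Bmult n p \<eta> a c + Bmult n p \<eta> b c"
proof -
  let ?S = "Poly_Mapping.keys a \<union> Poly_Mapping.keys b"
  have k: "Poly_Mapping.keys (a + b) \<subseteq> ?S" by (rule Poly_Mapping.keys_add)
  show ?thesis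
    using k by (subst (1 2 3) Bmult_superset[where S = ?S and T = "Poly_Mapping.keys c"])
      (auto simp: lookup_add distrib_right single_add sum.distrib)
qed

lemma Bmult_add_right: "Bmult n p \<eta> c (a + b) = Bmult n p \<eta> c a + Bmult n p \<eta> c b"
proof -
  let ?S = "Poly_Mapping.keys a \<union> Poly_Mapping.keys b"
  have k: "Poly_Mapping.keys (a + b) \<subseteq> ?S" by (rule Poly_Mapping.keys_add)
  show ?thesis
    using k by (subst (1 2 3) Bmult_superset[where T = ?S and S = "Poly_Mapping.keys c"])
      (auto simp: lookup_add distrib_left translate_add single_add sum.distrib)
qed

lemma Bmult_zero_left [simp]: "Bmult n p \<eta> 0 c = 0"
  and Bmult_zero_right [simp]: "Bmult n p \<eta> c 0 = 0"
  by (simp_all add: Bmult_def)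

lemma Bmult_sum_left: "Bmult n p \<eta> (\<Sum>i\<in>I. f i) c = (\<Sum>i\<in>I. Bmult n p \<eta> (f i) c)"
  by (induction I rule: infinite_finite_induct) (auto simp: Bmult_add_left)

lemma Bmult_sum_right: "Bmult n p \<eta> c (\<Sum>i\<in>I. f i) = (\<Sum>i\<in>I. Bmult n p \<eta> c (f i))"
  by (induction I rule: infinite_finite_induct) (auto simp: Bmult_add_right)

lemma Bmult_single:
  "Bmult n p \<eta> (Poly_Mapping.single m \<phi>) (Poly_Mapping.single k \<psi>) =
   Poly_Mapping.single (m + k) (\<phi> * translate (shift n p \<eta> m) \<psi>)"
  by (subst Bmult_superset[where S = "{m}" and T = "{k}"]) auto

lemma shift_add: "shift n p \<eta> (m + k) i = shift n p \<eta> m i + shift n p \<eta> k i"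
  by (cases i) (simp_all add: lookup_add sum.distrib distrib_right)

lemma shift_zero: "shift n p \<eta> 0 = (\<lambda>_. 0)"
proof
  show "shift n p \<eta> 0 i = 0" for i by (cases i) auto
qed

lemma balg_expand:
  fixes a :: balg
  shows "a = (\<Sum>m\<in>Poly_Mapping.keys a. Poly_Mapping.single m (Poly_Mapping.lookup a m))"
proof (rule poly_mapping_eqI)
  fix k
  have "Poly_Mapping.lookup (\<Sum>m\<in>Poly_Mapping.keys a. Poly_Mapping.single m (Poly_Mapping.lookup a m)) k
      = (\<Sum>m\<in>Poly_Mapping.keys a. if m = k then Poly_Mapping.lookup a k else 0)"
    unfolding lookup_sum by (intro sum.cong) (auto simp: lookup_single when_def)
  also have "\<dots> = Poly_Mapping.lookup a k"
    by (simp add: in_keys_iff)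
  finally show "Poly_Mapping.lookup a k = Poly_Mapping.lookup
    (\<Sum>m\<in>Poly_Mapping.keys a. Poly_Mapping.single m (Poly_Mapping.lookup a m)) k" ..
qed

lemma Bmult_assoc: "Bmult n p \<eta> (Bmult n p \<eta> a b) c = Bmult n p \<eta> a (Bmult n p \<eta> b c)"
proof -
  have *: "Bmult n p \<eta> (Bmult n p \<eta> (Poly_Mapping.single m \<phi>) (Poly_Mapping.single k \<psi>))
        (Poly_Mapping.single l \<omega>) =
      Bmult n p \<eta> (Poly_Mapping.single m \<phi>)
        (Bmult n p \<eta> (Poly_Mapping.single k \<psi>) (Poly_Mapping.single l \<omega>))"
    for m k l \<phi> \<psi> \<omega>
    by (simp add: Bmult_single translate_mult translate_translate shift_add[abs_def] add.assoc mult.assoc)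
  show ?thesis
    by (subst (1 2) balg_expand[of a], subst (1 2) balg_expand[of b], subst (1 2) balg_expand[of c])
       (simp only: Bmult_sum_left Bmult_sum_right *)
qed

lemma Bmult_one_left: "Bmult n p \<eta> 1 a = a"
proof -
  have "Bmult n p \<eta> (Poly_Mapping.single 0 1) a = 
    (\<Sum>m\<in>Poly_Mapping.keys a. Poly_Mapping.single m (Poly_Mapping.lookup a m))"
    by (subst (1) balg_expand[of a]) (simp only: Bmult_sum_right Bmult_single shift_zero
      translate_zero_vec mult_1_left add_0_left)
  then show ?thesis by (simp only: balg_expand[symmetric] single_one)
qed

lemma Bmult_one_right: "Bmult n p \<eta> a 1 = a"
proof -
  have "Bmult n p \<eta> a (Poly_Mapping.single 0 1) = 
    (\<Sum>m\<in>Poly_Mapping.keys a. Poly_Mapping.single m (Poly_Mapping.lookup a m))"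
    by (subst (1) balg_expand[of a]) (simp only: Bmult_sum_left Bmult_single
      translate_1 mult_1_right add_0_right)
  then show ?thesis by (simp only: balg_expand[symmetric] single_one)
qed

lemma Btilde_sel [simp]:
  "x \<otimes>\<^bsub>Btilde n p \<eta>\<^esub> y = Bmult n p \<eta> x y" "x \<oplus>\<^bsub>Btilde n p \<eta>\<^esub> y = x + y"
  "\<one>\<^bsub>Btilde n p \<eta>\<^esub> = 1" "\<zero>\<^bsub>Btilde n p \<eta>\<^esub> = 0"
  by (simp_all add: Btilde_def)

lemma Btilde_carrier_iff:
  "a \<in> carrier (Btilde n p \<eta>) \<longleftrightarrow> (\<forall>m\<in>Poly_Mapping.keys a.
     Poly_Mapping.keys m \<subseteq> gens n p \<and> Poly_Mapping.lookup a m \<in> Mero (vars n p))"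
  by (simp add: Btilde_def)

lemma Btilde_carrier_add:
  assumes "a \<in> carrier (Btilde n p \<eta>)" "b \<in> carrier (Btilde n p \<eta>)"
  shows "a + b \<in> carrier (Btilde n p \<eta>)"
  unfolding Btilde_carrier_iff
proof
  fix m assume m: "m \<in> Poly_Mapping.keys (a + b)"
  then have "m \<in> Poly_Mapping.keys a \<union> Poly_Mapping.keys b"
    by (rule subsetD[OF Poly_Mapping.keys_add])
  moreover have "Poly_Mapping.lookup c m \<in> Mero (vars n p)" if "c \<in> carrier (Btilde n p \<eta>)" for c
    using that Mero_0[of "vars n p"] unfolding Btilde_carrier_iff
    by (cases "m \<in> Poly_Mapping.keys c") (simp_all add: in_keys_iff)
  ultimately show "Poly_Mapping.keys m \<subseteq> gens n p \<and> Poly_Mapping.lookup (a + b) m \<in> Mero (vars n p)"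
    using assms by (auto simp: lookup_add Btilde_carrier_iff[THEN iffD1] intro!: Mero_add) (auto simp: Btilde_carrier_iff)
qed

lemma Btilde_carrier_zero: "0 \<in> carrier (Btilde n p \<eta>)"
  by (simp add: Btilde_carrier_iff)

lemma Btilde_carrier_sum:
  "(\<And>i. i \<in> I \<Longrightarrow> f i \<in> carrier (Btilde n p \<eta>)) \<Longrightarrow> (\<Sum>i\<in>I. f i) \<in> carrier (Btilde n p \<eta>)"
  by (induction I rule: infinite_finite_induct)
     (auto intro: Btilde_carrier_add Btilde_carrier_zero)

lemma Btilde_carrier_single:
  "Poly_Mapping.keys m \<subseteq> gens n p \<Longrightarrow> \<phi> \<in> Mero (vars n p) \<Longrightarrow>
   Poly_Mapping.single m \<phi> \<in> carrier (Btilde n p \<eta>)"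
  by (auto simp: Btilde_carrier_iff lookup_single split: if_splits)

lemma Btilde_carrier_mult:
  assumes "a \<in> carrier (Btilde n p \<eta>)" "b \<in> carrier (Btilde n p \<eta>)"
  shows "Bmult n p \<eta> a b \<in> carrier (Btilde n p \<eta>)"
  unfolding Bmult_def
proof (intro Btilde_carrier_sum Btilde_carrier_single)
  fix m k assume "m \<in> Poly_Mapping.keys a" "k \<in> Poly_Mapping.keys b"
  then show "Poly_Mapping.keys (m + k) \<subseteq> gens n p"
    using assms Poly_Mapping.keys_add[of m k] unfolding Btilde_carrier_iff by blast
qed (use assms in \<open>auto simp: Btilde_carrier_iff intro!: Mero_mult Mero_translate\<close>)

lemma ring_Btilde: "ring (Btilde n p \<eta>)"
proof (rule ringI)
  show "abelian_group (Btilde n p \<eta>)"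
  proof (rule abelian_groupI)
    fix x assume "x \<in> carrier (Btilde n p \<eta>)"
    then have "- x \<in> carrier (Btilde n p \<eta>)"
      unfolding Btilde_carrier_iff by (auto intro: Mero_uminus)
    then show "\<exists>y\<in>carrier (Btilde n p \<eta>). y \<oplus>\<^bsub>Btilde n p \<eta>\<^esub> x = \<zero>\<^bsub>Btilde n p \<eta>\<^esub>"
      by (intro bexI[of _ "- x"]) simp_all
  qed (simp_all add: Btilde_carrier_add Btilde_carrier_zero add_ac)
  show "Group.monoid (Btilde n p \<eta>)"
    using Btilde_carrier_single[of 0 n p 1 \<eta>]
    by (intro monoidI) (simp_all add: Btilde_carrier_mult Mero_1
      Bmult_assoc Bmult_one_left Bmult_one_right)
qed (simp_all add: Bmult_add_left Bmult_add_right)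

definition mono_elem :: "gen \<Rightarrow> balg" where
  "mono_elem g = Poly_Mapping.single (Poly_Mapping.single g 1) 1"

definition fun_elem :: "((var \<Rightarrow> complex) \<Rightarrow> complex) \<Rightarrow> balg" where
  "fun_elem \<phi> = Poly_Mapping.single 0 (gfun_of \<phi>)"

lemma mono_elem_fun_elem:
  "mono_elem g \<otimes>\<^bsub>Btilde n p \<eta>\<^esub> fun_elem \<phi> =
   fun_elem (\<lambda>x. \<phi> (\<lambda>i. x i - shift n p \<eta> (Poly_Mapping.single g 1) i)) \<otimes>\<^bsub>Btilde n p \<eta>\<^esub> mono_elem g"
proof -
  have "translate c (gfun_of \<phi>) = gfun_of (\<lambda>x. \<phi> (\<lambda>i. x i - c i))" for c
    by transfer (simp add: generic_eq_refl)
  then show ?thesis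
    by (simp add: mono_elem_def fun_elem_def Bmult_single)
qed

lemma e_z_relation:
  assumes "1 \<le> \<alpha>" "\<alpha> \<le> p \<gamma>"
  shows "mono_elem (egen \<alpha> \<gamma>) \<otimes>\<^bsub>Btilde n p \<eta>\<^esub> fun_elem (\<lambda>x. x (zvar \<beta> \<delta>)) =
    fun_elem (\<lambda>x. x (zvar \<beta> \<delta>) - (if \<delta> = \<gamma> \<and> \<beta> \<noteq> \<alpha> then of_nat n * \<eta> else 0))
      \<otimes>\<^bsub>Btilde n p \<eta>\<^esub> mono_elem (egen \<alpha> \<gamma>)"
proof -
  have "(\<Sum>\<alpha>'\<in>{1..p \<delta>} - {\<beta>}. Poly_Mapping.lookup (Poly_Mapping.single (egen \<alpha> \<gamma>) (1::nat)) (egen \<alpha>' \<delta>))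
      = (\<Sum>\<alpha>'\<in>{1..p \<delta>} - {\<beta>}. if \<alpha>' = \<alpha> then (if \<delta> = \<gamma> then 1 else 0) else 0)"
    by (intro sum.cong) (auto simp: lookup_single when_def)
  also have "\<dots> = (if \<delta> = \<gamma> \<and> \<beta> \<noteq> \<alpha> then 1 else 0)"
    using assms by auto
  finally show ?thesis
    unfolding mono_elem_fun_elem shift.simps by (simp only: of_nat_1 of_nat_0 mult_1 mult_zero_left
      if_distrib[where f = of_nat] if_distrib[where f = "\<lambda>c. c * (of_nat n * \<eta>)"])
qed

lemma f_t_relation:
  "mono_elem (fgen \<gamma>) \<otimes>\<^bsub>Btilde n p \<eta>\<^esub> fun_elem (\<lambda>x. x (tvar \<delta>)) =
    fun_elem (\<lambda>x. x (tvar \<delta>) - (if \<delta> = \<gamma> then of_nat n * \<eta> else 0))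
      \<otimes>\<^bsub>Btilde n p \<eta>\<^esub> mono_elem (fgen \<gamma>)"
  unfolding mono_elem_fun_elem by (auto simp: lookup_single when_def)

lemma e_t_f_z_relations:
  "mono_elem (egen \<alpha> \<gamma>) \<otimes>\<^bsub>Btilde n p \<eta>\<^esub> fun_elem (\<lambda>x. x (tvar \<delta>)) =
     fun_elem (\<lambda>x. x (tvar \<delta>)) \<otimes>\<^bsub>Btilde n p \<eta>\<^esub> mono_elem (egen \<alpha> \<gamma>)"
  "mono_elem (fgen \<gamma>) \<otimes>\<^bsub>Btilde n p \<eta>\<^esub> fun_elem (\<lambda>x. x (zvar \<beta> \<delta>)) =
     fun_elem (\<lambda>x. x (zvar \<beta> \<delta>)) \<otimes>\<^bsub>Btilde n p \<eta>\<^esub> mono_elem (fgen \<gamma>)"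
  unfolding mono_elem_fun_elem by (simp_all add: lookup_single when_def)

lemma commuting_relations:
  "mono_elem g \<otimes>\<^bsub>Btilde n p \<eta>\<^esub> mono_elem h = mono_elem h \<otimes>\<^bsub>Btilde n p \<eta>\<^esub> mono_elem g"
  "fun_elem \<phi> \<otimes>\<^bsub>Btilde n p \<eta>\<^esub> fun_elem \<psi> = fun_elem \<psi> \<otimes>\<^bsub>Btilde n p \<eta>\<^esub> fun_elem \<phi>"
  by (simp_all add: mono_elem_def fun_elem_def Bmult_single shift_zero add.commute mult.commute)

section \<open>The elements \<open>T(u)\<close>\<close>

definition theta_order1 :: "complex \<Rightarrow> (complex \<Rightarrow> complex) \<Rightarrow> bool" where
  "theta_order1 \<tau> \<theta> \<longleftrightarrow> \<theta> holomorphic_on UNIV \<and> (\<exists>z. \<theta> z \<noteq> 0) \<and>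
     (\<forall>z. \<theta> (z + 1) = \<theta> z) \<and>
     (\<forall>z. \<theta> (z + \<tau>) = \<theta> (- z)) \<and>
     (\<forall>z. \<theta> (- z) = - exp (- 2 * of_real pi * \<i> * z) * \<theta> z) \<and>
     \<theta> 0 = 0"

definition Tnum :: "nat \<Rightarrow> (complex \<Rightarrow> complex) \<Rightarrow> complex \<Rightarrow> (nat \<Rightarrow> nat) \<Rightarrow> (var \<Rightarrow> complex) \<Rightarrow> complex" where
  "Tnum n \<theta> u \<alpha> x =
     \<theta> (u - x (zvar (\<alpha> 1) 1)) *
     (\<Prod>\<gamma>=1..n-2. \<theta> (u + x (zvar (\<alpha> \<gamma>) \<gamma>) - x (zvar (\<alpha> (\<gamma> + 1)) (\<gamma> + 1)))) *
     \<theta> (u + x (zvar (\<alpha> (n - 1)) (n - 1)))"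

definition Tden :: "nat \<Rightarrow> (nat \<Rightarrow> nat) \<Rightarrow> (complex \<Rightarrow> complex) \<Rightarrow> (nat \<Rightarrow> nat) \<Rightarrow> (var \<Rightarrow> complex) \<Rightarrow> complex" where
  "Tden n p \<theta> \<alpha> x =
     (\<Prod>\<gamma>=1..n-1. \<Prod>\<beta>\<in>{1..p \<gamma>} - {\<alpha> \<gamma>}. \<theta> (x (zvar (\<alpha> \<gamma>) \<gamma>) - x (zvar \<beta> \<gamma>)))"

definition Ttail :: "nat \<Rightarrow> (complex \<Rightarrow> complex) \<Rightarrow> (nat \<Rightarrow> nat) \<Rightarrow> (var \<Rightarrow> complex) \<Rightarrow> complex" where
  "Ttail n \<theta> \<alpha> x =
     (\<Prod>\<gamma>=1..n-2. \<theta> (x (zvar (\<alpha> \<gamma>) \<gamma>) + x (zvar (\<alpha> (\<gamma> + 1)) (\<gamma> + 1)) - x (tvar \<gamma>)))"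

definition Tmono :: "nat \<Rightarrow> (nat \<Rightarrow> nat) \<Rightarrow> (gen \<Rightarrow>\<^sub>0 nat)" where
  "Tmono n \<alpha> = (\<Sum>\<gamma>=1..n-1. Poly_Mapping.single (egen (\<alpha> \<gamma>) \<gamma>) 1) +
     (\<Sum>\<gamma>=1..n-2. Poly_Mapping.single (fgen \<gamma>) 1)"

definition Ttilde :: "nat \<Rightarrow> (nat \<Rightarrow> nat) \<Rightarrow> (complex \<Rightarrow> complex) \<Rightarrow> complex \<Rightarrow> balg" where
  "Ttilde n p \<theta> u = (\<Sum>\<alpha>\<in>(\<Pi>\<^sub>E \<gamma>\<in>{1..n-1}. {1..p \<gamma>}).
     Poly_Mapping.single (Tmono n \<alpha>)
       (gfun_of (\<lambda>x. Tnum n \<theta> u \<alpha> x / Tden n p \<theta> \<alpha> x * Ttail n \<theta> \<alpha> x)))"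

lemma holomorphic_multi_prod:
  "(\<And>j. j \<in> J \<Longrightarrow> holomorphic_multi U (f j)) \<Longrightarrow> holomorphic_multi U (\<lambda>x. \<Prod>j\<in>J. f j x)"
  by (induction J rule: infinite_finite_induct)
     (auto intro: holomorphic_multi_const holomorphic_multi_mult)

lemma holomorphic_multi_uminus: "holomorphic_multi U f \<Longrightarrow> holomorphic_multi U (\<lambda>x. - f x)"
  using holomorphic_multi_mult[OF holomorphic_multi_const[of U "-1"], of f] by simp

lemma holomorphic_multi_diff:
  "holomorphic_multi U f \<Longrightarrow> holomorphic_multi U g \<Longrightarrow> holomorphic_multi U (\<lambda>x. f x - g x)"
  using holomorphic_multi_add[OF _ holomorphic_multi_uminus, of U f g] by simp

lemma holomorphic_multi_coord: "holomorphic_multi U (\<lambda>x. x i)"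
proof -
  have "(\<lambda>w. (x(j := w)) i) field_differentiable (at (x j))" for x :: "'a \<Rightarrow> complex" and j
    by (cases "i = j") (auto intro!: derivative_intros simp: fun_upd_def field_differentiable_ident)
  then show ?thesis
    unfolding holomorphic_multi_def
    by (auto intro: continuous_on_subset[OF continuous_on_product_coordinates])
qed

lemma holomorphic_multi_compose:
  assumes "\<theta> holomorphic_on UNIV" "holomorphic_multi U f"
  shows "holomorphic_multi U (\<lambda>x. \<theta> (f x))"
  unfolding holomorphic_multi_def
proof (intro conjI ballI allI)
  show "continuous_on U (\<lambda>x. \<theta> (f x))"
    using assms by (intro continuous_on_compose2[OF holomorphic_on_imp_continuous_on[OF assms(1)]])
      (auto simp: holomorphic_multi_def)
  fix x i assume "x \<in> U"
  then have "(\<lambda>w. f (x(i := w))) field_differentiable (at (x i))"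
    using assms(2) unfolding holomorphic_multi_def by blast
  moreover have "\<theta> field_differentiable at w within S" for w S
    using assms(1) field_differentiable_at_within
    by (metis UNIV_I holomorphic_on_def)
  ultimately have "\<theta> \<circ> (\<lambda>w. f (x(i := w))) field_differentiable (at (x i))"
    by (intro field_differentiable_compose) auto
  then show "(\<lambda>w. \<theta> (f (x(i := w)))) field_differentiable (at (x i))"
    by (simp add: o_def)
qed

lemma depends_on_prod:
  "(\<And>j. j \<in> J \<Longrightarrow> depends_on V (f j)) \<Longrightarrow> depends_on V (\<lambda>x. \<Prod>j\<in>J. f j x)"
  unfolding depends_on_def by (meson prod.cong)

lemma open_nz:
  assumes "holomorphic_multi UNIV h" shows "open {x. h x \<noteq> 0}"
  using holomorphic_multi_open_nz[OF open_UNIV assms] by simp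

lemma dense_set_prod_nz:
  assumes "finite J" "\<And>j. j \<in> J \<Longrightarrow> holomorphic_multi UNIV (f j)"
    "\<And>j. j \<in> J \<Longrightarrow> dense_set {x. f j x \<noteq> 0}"
  shows "dense_set {x. (\<Prod>j\<in>J. f j x) \<noteq> 0}"
  using assms
proof (induction J rule: finite_induct)
  case empty
  then show ?case by (simp add: dense_set_UNIV)
next
  case (insert j J)
  have "dense_set ({x. f j x \<noteq> 0} \<inter> {x. (\<Prod>j\<in>J. f j x) \<noteq> 0})"
    using insert by (intro dense_set_Int open_nz) auto
  moreover have "{x. f j x \<noteq> 0} \<inter> {x. (\<Prod>j\<in>J. f j x) \<noteq> 0} = {x. (\<Prod>j\<in>insert j J. f j x) \<noteq> 0}"
    using insert.hyps by auto
  ultimately show ?case by simp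
qed

lemma dense_set_theta_nz:
  assumes th: "\<theta> holomorphic_on UNIV" "\<theta> w0 \<noteq> 0" and "i \<noteq> j"
  shows "dense_set {x :: 'i \<Rightarrow> complex. \<theta> (x i - x j) \<noteq> 0}"
  unfolding dense_set_iff
proof (intro allI impI)
  fix U :: "('i \<Rightarrow> complex) set" assume "open U" "U \<noteq> {}"
  then obtain a where a: "a \<in> U" by blast
  let ?l = "\<lambda>w. a(i := w)"
  have "continuous_on UNIV ?l"
  proof (rule continuous_on_coordinatewise_then_product)
    show "continuous_on UNIV (\<lambda>w. (a(i := w)) k)" for k
      by (cases "k = i") (auto intro: continuous_intros)
  qed
  then have op: "open (?l -` U)" using \<open>open U\<close> by (simp add: continuous_on_open_vimage)
  have ne: "a i \<in> ?l -` U" using a by simp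
  have hol: "(\<lambda>w. \<theta> (w - a j)) holomorphic_on UNIV"
  proof -
    have "(\<lambda>w. w - a j) holomorphic_on UNIV" by (intro holomorphic_intros)
    then show ?thesis
      using holomorphic_on_compose_gen[of "\<lambda>w. w - a j" UNIV \<theta> UNIV] th(1)
      by (simp add: o_def)
  qed
  show "U \<inter> {x. \<theta> (x i - x j) \<noteq> 0} \<noteq> {}"
  proof
    assume emp: "U \<inter> {x. \<theta> (x i - x j) \<noteq> 0} = {}"
    have z: "\<theta> (w - a j) = 0" if "w \<in> ?l -` U" for w
    proof -
      have "?l w \<in> U" using that by simp
      then have "\<theta> ((?l w) i - (?l w) j) = 0" using emp by blast
      then show ?thesis using \<open>i \<noteq> j\<close> by simp
    qed
    have "\<theta> ((w0 + a j) - a j) = 0"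
      by (rule analytic_continuation_open[where s = "?l -` U" and s' = UNIV and g = "\<lambda>_. 0", 
          OF op open_UNIV _ _ _ hol])
         (use ne z in auto)
    then show False using th(2) by simp
  qed
qed

lemma Ttilde_carrier:
  assumes th: "theta_order1 \<tau> \<theta>" and n: "n \<ge> 2"
  shows "Ttilde n p \<theta> u \<in> carrier (Btilde n p \<eta>)"
  unfolding Ttilde_def
proof (intro Btilde_carrier_sum Btilde_carrier_single gfun_of_in_Mero)
  fix \<alpha> assume \<alpha>: "\<alpha> \<in> (\<Pi>\<^sub>E \<gamma>\<in>{1..n-1}. {1..p \<gamma>})"
  have hol: "\<theta> holomorphic_on UNIV" using th by (simp add: theta_order1_def)
  obtain w0 where w0: "\<theta> w0 \<noteq> 0" using th by (auto simp: theta_order1_def)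
  have za: "zvar (\<alpha> \<gamma>) \<gamma> \<in> vars n p" if "\<gamma> \<in> {1..n-1}" for \<gamma>
    using \<alpha> that unfolding vars_def PiE_iff by blast
  have zb: "zvar \<beta> \<gamma> \<in> vars n p" if "\<gamma> \<in> {1..n-1}" "\<beta> \<in> {1..p \<gamma>}" for \<beta> \<gamma>
    using that unfolding vars_def by blast
  have tv: "tvar \<gamma> \<in> vars n p" if "\<gamma> \<in> {1..n-2}" for \<gamma>
    using that unfolding vars_def by blast
  note hi = holomorphic_multi_mult holomorphic_multi_prod holomorphic_multi_compose[OF hol]
    holomorphic_multi_add holomorphic_multi_diff holomorphic_multi_const holomorphic_multi_coord
  have hT: "holomorphic_multi UNIV (Tnum n \<theta> u \<alpha>)" "holomorphic_multi UNIV (Tden n p \<theta> \<alpha>)"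
    "holomorphic_multi UNIV (Ttail n \<theta> \<alpha>)"
    unfolding Tnum_def[abs_def] Tden_def[abs_def] Ttail_def[abs_def] by (intro hi)+
  have dc: "depends_on (vars n p) (\<lambda>x. x i)" if "i \<in> vars n p" for i
    using that by (simp add: depends_on_def)
  have dk: "depends_on (vars n p) (\<lambda>x. c)" for c by (simp add: depends_on_def)
  have dt: "depends_on (vars n p) (\<lambda>x. \<theta> (f x))" if "depends_on (vars n p) f" for f
    using depends_on_binop[OF that that, of "\<lambda>a b. \<theta> a"] .
  note di = depends_on_binop[where F = "(*)"] depends_on_binop[where F = "(+)"]
    depends_on_binop[where F = "(-)"] depends_on_prod dc dk dt
  have dT: "depends_on (vars n p) (Tnum n \<theta> u \<alpha>)" "depends_on (vars n p) (Tden n p \<theta> \<alpha>)"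
    "depends_on (vars n p) (Ttail n \<theta> \<alpha>)"
    unfolding Tnum_def[abs_def] Tden_def[abs_def] Ttail_def[abs_def]
    by (intro di za zb tv; use n in auto)+
  have "dense_set {x. Tden n p \<theta> \<alpha> x \<noteq> 0}"
    unfolding Tden_def
    by (intro dense_set_prod_nz hi dense_set_theta_nz[OF hol w0]) auto
  then have "meromorphic_multi (vars n p) (\<lambda>x. (Tnum n \<theta> u \<alpha> x * Ttail n \<theta> \<alpha> x) / Tden n p \<theta> \<alpha> x)"
    using hT dT by (intro meromorphic_multi_quotient hi di)
  then show "meromorphic_multi (vars n p) (\<lambda>x. Tnum n \<theta> u \<alpha> x / Tden n p \<theta> \<alpha> x * Ttail n \<theta> \<alpha> x)"
    by simp
  show "Poly_Mapping.keys (Tmono n \<alpha>) \<subseteq> gens n p"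
  proof -
    have "Poly_Mapping.keys (Tmono n \<alpha>) \<subseteq>
       (\<Union>\<gamma>\<in>{1..n-1}. {egen (\<alpha> \<gamma>) \<gamma>}) \<union> (\<Union>\<gamma>\<in>{1..n-2}. {fgen \<gamma>})"
      unfolding Tmono_def
      by (intro order_trans[OF Poly_Mapping.keys_add] Un_mono order_trans[OF keys_sum] UN_mono) auto
    then show ?thesis using \<alpha> unfolding gens_def PiE_iff by blast
  qed
qed

definition commutator :: "('a, 'b) ring_scheme \<Rightarrow> 'a \<Rightarrow> 'a \<Rightarrow> 'a" where
  "commutator R a b = a \<otimes>\<^bsub>R\<^esub> b \<ominus>\<^bsub>R\<^esub> b \<otimes>\<^bsub>R\<^esub> a"

end

theory Submission
  imports Defs
begin

text \<open>
  Write \<open>\<theta> z = exp (\<pi> \<i> z) s z\<close> with \<open>s\<close> odd, and let \<open>h = n \<eta>\<close>. In the product of the elements at \<open>u\<close>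
  and \<open>v\<close> the coefficient of a monomial is a sum over pairs of paths \<open>(\<alpha>, \<beta>)\<close>. A pair chooses a state
  \<open>(i, j) = (\<alpha>\<^bsub>\<gamma>\<^esub>, \<beta>\<^bsub>\<gamma>\<^esub>)\<close> at every level \<open>\<gamma>\<close>, and the monomial does not change when \<open>i\<close> and \<open>j\<close> are swapped
  at one level. The summand is a product of factors for the ends of the path, for the levels and for
  pairs of adjacent levels. Therefore the sum is a product of \<open>2 \<times> 2\<close> matrices, or of scalars at the
  levels with \<open>i = j\<close>, between two boundary vectors, and the claim is that it is symmetric in \<open>u\<close> and \<open>v\<close>.
  
  The reason is the existence of an intertwiner, the elliptic dynamical \<open>R\<close>-matrix with spectral
  parameter \<open>u - v\<close> and dynamical parameter \<open>z i - z j\<close>. It exchanges \<open>u\<close> and \<open>v\<close> in the first boundary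
  vector (\<open>left_exchange\<close>), commutes past the matrices between adjacent levels while exchanging \<open>u\<close> and
  \<open>v\<close> in them (\<open>link_exchange\<close>), and is absorbed by the last boundary vector (\<open>right_exchange\<close>). It
  passes through the denominators of a level because these make it self-adjoint (\<open>site_exch_dual\<close>).
  The formal argument is \<open>path_exchange.path_sums_agree\<close>. It yields the symmetry up to the factor
  \<open>s (u - v - h)\<close>, which is cancelled by continuity in \<open>u\<close>.
  
  Every exchange relation is a combination of instances of the three-term relation for \<open>s\<close>
  (\<open>theta_bracket_Pluecker\<close>). That relation is a Pluecker relation: \<open>s (a + b) * s (a - b)\<close> is
  antisymmetric, and as a function of \<open>a\<close> it is a theta function of degree two. These functions form a
  space of dimension at most two, because translation by \<open>\<tau>\<close> relates their Fourier coefficients of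
  index \<open>k\<close> and \<open>k - 2\<close>, and an entire periodic function whose Fourier coefficients all vanish is zero.
\<close>

section \<open>Entire periodic functions with vanishing Fourier coefficients\<close>

text \<open>
  The zeroth Fourier coefficient; the others are obtained by multiplying with characters.
\<close>

definition period_integral :: "(complex \<Rightarrow> complex) \<Rightarrow> complex" where
  "period_integral F = contour_integral (linepath 0 1) F"

definition fourier_char :: "int \<Rightarrow> complex \<Rightarrow> complex" where
  "fourier_char k z = exp (2 * of_real pi * \<i> * of_int k * z)"

lemma entire_primitive:
  assumes "F holomorphic_on UNIV"
  obtains \<Phi> where "\<And>z. (\<Phi> has_field_derivative F z) (at z)"
  using holomorphic_convex_primitive'[OF convex_UNIV open_UNIV assms] by auto

lemma period_integral_primitive:
  assumes "\<And>z. (\<Phi> has_field_derivative F z) (at z)"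
  shows "period_integral F = \<Phi> 1 - \<Phi> 0"
proof -
  have "(F has_contour_integral (\<Phi> (pathfinish (linepath 0 1)) - \<Phi> (pathstart (linepath 0 1)))) (linepath 0 1)"
    by (rule contour_integral_primitive[OF has_field_derivative_at_within[OF assms] valid_path_linepath subset_UNIV])
  then show ?thesis
    unfolding period_integral_def by (simp add: contour_integral_unique)
qed

lemma entire_integrable_linepath:
  "F holomorphic_on UNIV \<Longrightarrow> F contour_integrable_on linepath a b"
  by (rule contour_integrable_holomorphic_simple[where S = UNIV]) auto

lemma period_integral_add:
  "F holomorphic_on UNIV \<Longrightarrow> G holomorphic_on UNIV \<Longrightarrow>
    period_integral (\<lambda>z. F z + G z) = period_integral F + period_integral G"
  unfolding period_integral_def by (intro contour_integral_add entire_integrable_linepath)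

lemma period_integral_cmult:
  "F holomorphic_on UNIV \<Longrightarrow> period_integral (\<lambda>z. c * F z) = c * period_integral F"
  unfolding period_integral_def by (intro contour_integral_lmul entire_integrable_linepath)

lemma entire_translate: "F holomorphic_on UNIV \<Longrightarrow> (\<lambda>z. F (z + a)) holomorphic_on UNIV"
  by (rule holomorphic_on_compose_gen[of "\<lambda>z. z + a" UNIV F UNIV, unfolded o_def])
     (auto intro!: holomorphic_intros)

text \<open>
  A primitive \<open>\<Phi>\<close> of a periodic function has constant increment \<open>\<Phi> (z + 1) - \<Phi> z\<close>, so no contour
  deformation is needed to move the segment of integration. Moving it off the real axis gives the
  decay of Fourier coefficients, moving it by \<open>\<tau>\<close> the recursion for those of theta functions.
\<close>

lemma period_integral_translate:
  assumes "F holomorphic_on UNIV" and per: "\<And>z. F (z + 1) = F z"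
  shows "period_integral (\<lambda>z. F (z + a)) = period_integral F"
proof -
  obtain \<Phi> where \<Phi>: "\<And>z. (\<Phi> has_field_derivative F z) (at z)"
    using entire_primitive[OF assms(1)] by blast
  have tr: "((\<lambda>z. \<Phi> (z + b)) has_field_derivative F (z + b)) (at z)" for b z
  proof -
    have "((\<lambda>z. z + b) has_field_derivative 1) (at z)" by (auto intro!: derivative_eq_intros)
    from DERIV_chain2[of \<Phi> "F (z + b)" "\<lambda>z. z + b", OF \<Phi> this] show ?thesis by simp
  qed
  have "((\<lambda>z. \<Phi> (z + 1) - \<Phi> z) has_field_derivative 0) (at z)" for z
    using DERIV_diff[OF tr[of 1 z] \<Phi>[of z]] per by simp
  then obtain c where "\<And>z. \<Phi> (z + 1) - \<Phi> z = c"
    using has_field_derivative_zero_constant[of UNIV "\<lambda>z. \<Phi> (z + 1) - \<Phi> z"] by auto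
  then have "\<Phi> (a + 1) - \<Phi> a = \<Phi> (0 + 1) - \<Phi> 0" by metis
  moreover have "period_integral (\<lambda>z. F (z + a)) = \<Phi> (1 + a) - \<Phi> (0 + a)"
    by (rule period_integral_primitive[where \<Phi> = "\<lambda>z. \<Phi> (z + a)"]) (rule tr)
  ultimately show ?thesis using period_integral_primitive[OF \<Phi>] by (simp add: add.commute)
qed

lemma period_integral_bound:
  assumes "F holomorphic_on UNIV" "\<And>z. F (z + 1) = F z"
    and "\<And>t. t \<in> closed_segment 0 1 \<Longrightarrow> norm (F (t + a)) \<le> B" and "0 \<le> B"
  shows "norm (period_integral F) \<le> B"
proof -
  have "norm (contour_integral (linepath 0 1) (\<lambda>z. F (z + a))) \<le> B * norm (1 - 0 :: complex)"
    by (intro contour_integral_bound_linepath entire_integrable_linepath entire_translate assms)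
  then show ?thesis
    using period_integral_translate[OF assms(1,2), of a] by (simp add: period_integral_def)
qed

lemma fourier_char_holomorphic: "fourier_char k holomorphic_on UNIV"
  unfolding fourier_char_def[abs_def] by (intro holomorphic_intros)

lemma fourier_char_translate: "fourier_char k (z + w) = fourier_char k z * fourier_char k w"
  by (simp add: fourier_char_def distrib_left exp_add)

lemma fourier_char_add: "fourier_char (k + l) z = fourier_char k z * fourier_char l z"
  by (simp add: fourier_char_def distrib_left distrib_right exp_add)

lemma fourier_char_one: "fourier_char k 1 = 1"
  using exp_integer_2pi[of "of_int k"] by (simp add: fourier_char_def mult_ac)

lemma fourier_char_periodic: "fourier_char k (z + 1) = fourier_char k z"
  by (simp add: fourier_char_translate fourier_char_one)

lemma period_integral_fourier_char:
  "period_integral (fourier_char k) = (if k = 0 then 1 else 0)"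
proof (cases "k = 0")
  case True
  then have "fourier_char k = (\<lambda>_. 1)" by (simp add: fourier_char_def fun_eq_iff)
  then show ?thesis
    using True period_integral_primitive[of "\<lambda>z. z" "\<lambda>_. 1"] by simp
next
  case False
  define c where "c = 2 * of_real pi * \<i> * of_int k"
  have c: "c \<noteq> 0" using False by (simp add: c_def)
  have e: "fourier_char k z = exp (c * z)" for z by (simp add: fourier_char_def c_def)
  have "((\<lambda>z. fourier_char k z / c) has_field_derivative fourier_char k z) (at z)" for z
    unfolding e using c by (auto intro!: derivative_eq_intros)
  from period_integral_primitive[OF this] show ?thesis
    using False fourier_char_one[of k] by (simp only: if_False) (simp add: fourier_char_def)
qed

lemma norm_fourier_char: "norm (fourier_char k z) = exp (- 2 * pi * of_int k * Im z)"
  by (simp add: fourier_char_def)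

lemma fourier_char_1_eq_1: "fourier_char 1 z = 1 \<longleftrightarrow> z \<in> \<int>"
proof
  assume "fourier_char 1 z = 1"
  then obtain m :: int where "Im z = 0" "2 * pi * Re z = of_int (2 * m) * pi"
    unfolding fourier_char_def exp_eq_1 by auto
  then have "z = of_int m" by (auto simp: complex_eq_iff)
  then show "z \<in> \<int>" by simp
next
  assume "z \<in> \<int>"
  then obtain m where "z = of_int m" by (auto elim: Ints_cases)
  then show "fourier_char 1 z = 1"
    using fourier_char_one[of m] by (simp add: fourier_char_def)
qed

lemma periodic_int:
  fixes F :: "complex \<Rightarrow> 'b"
  assumes "\<And>z. F (z + 1) = F z"
  shows "F (z + of_int m) = F z"
proof -
  have n: "F (z + of_nat n) = F z" for n z
  proof (induction n)
    case (Suc n) then show ?case using assms[of "z + of_nat n"] by (simp add: add_ac)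
  qed simp
  show ?thesis
  proof (cases "m \<ge> 0")
    case True then show ?thesis using n[of z "nat m"] by simp
  next
    case False then show ?thesis using n[of "z + of_int m" "nat (- m)"] by simp
  qed
qed

text \<open>
  Near a zero \<open>a\<close> of \<open>E\<close> both functions are divisible by \<open>z - a\<close>, and \<open>E / (z - a)\<close> does not vanish
  there; the derivatives in \<open>q\<close> are the values of these two quotients at \<open>a\<close>.
\<close>

lemma entire_quotient_simple_zeros:
  assumes hg: "g holomorphic_on UNIV" and hE: "E holomorphic_on UNIV"
    and zero: "\<And>z. E z = 0 \<Longrightarrow> g z = 0" and simple: "\<And>z. E z = 0 \<Longrightarrow> deriv E z \<noteq> 0"
  defines "q \<equiv> \<lambda>z. if E z = 0 then deriv g z / deriv E z else g z / E z"
  shows "q holomorphic_on UNIV" "g z = E z * q z"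
proof -
  show "g z = E z * q z" using zero by (simp add: q_def)
  have "q field_differentiable at a" for a
  proof (cases "E a = 0")
    case False
    have "open (E -` (- {0}))"
      using holomorphic_on_imp_continuous_on[OF hE] by (intro open_vimage) auto
    moreover have "(\<lambda>z. g z / E z) holomorphic_on (E -` (- {0}))"
      by (intro holomorphic_intros holomorphic_on_subset[OF hg] holomorphic_on_subset[OF hE]) auto
    then have "q holomorphic_on (E -` (- {0}))"
      by (rule holomorphic_transform) (auto simp: q_def)
    ultimately show ?thesis using False
      by (auto simp: holomorphic_on_open field_differentiable_def)
  next
    case True
    define g1 where "g1 = (\<lambda>z. if z = a then deriv g a else (g z - g a) / (z - a))"
    define E1 where "E1 = (\<lambda>z. if z = a then deriv E a else (E z - E a) / (z - a))"
    have h1: "g1 holomorphic_on UNIV" "E1 holomorphic_on UNIV"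
      unfolding g1_def E1_def by (auto intro!: pole_lemma_open hg hE)
    have "open (E1 -` (- {0}))"
      using holomorphic_on_imp_continuous_on[OF h1(2)] by (intro open_vimage) auto
    moreover have "(\<lambda>z. g1 z / E1 z) holomorphic_on (E1 -` (- {0}))"
      by (intro holomorphic_intros holomorphic_on_subset[OF h1(1)] holomorphic_on_subset[OF h1(2)]) auto
    then have "q holomorphic_on (E1 -` (- {0}))"
      by (rule holomorphic_transform) (use True zero in \<open>auto simp: q_def g1_def E1_def\<close>)
    moreover have "a \<in> E1 -` (- {0})" using simple[OF True] by (simp add: E1_def)
    ultimately show ?thesis
      by (auto simp: holomorphic_on_open field_differentiable_def)
  qed
  then show "q holomorphic_on UNIV"
    by (simp add: holomorphic_on_def field_differentiable_at_within)
qed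

lemma periodic_quotient:
  assumes hg: "g holomorphic_on UNIV" and per: "\<And>z. g (z + 1) = g z" and "g 0 = 0"
  obtains q where "q holomorphic_on UNIV" "\<And>z. q (z + 1) = q z"
    "\<And>z. g z = (1 - fourier_char 1 z) * q z"
proof -
  define E where "E = (\<lambda>z. 1 - fourier_char 1 z)"
  have hE: "E holomorphic_on UNIV"
    unfolding E_def by (intro holomorphic_intros fourier_char_holomorphic)
  have Eper: "E (z + 1) = E z" for z by (simp add: E_def fourier_char_periodic)
  have dE: "deriv E z = - 2 * of_real pi * \<i> * fourier_char 1 z" for z
    unfolding E_def fourier_char_def
    by (rule DERIV_imp_deriv) (auto intro!: derivative_eq_intros)
  have dper: "deriv F (z + 1) = deriv F z" if "\<And>z. F (z + 1) = F z" for F :: "complex \<Rightarrow> complex" and z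
  proof -
    have "(\<lambda>x. F (z + 1 + x)) = (\<lambda>x. F (z + x))"
      using that[of "z + x" for x] by (simp add: add_ac fun_eq_iff)
    then show ?thesis
      using deriv_shift_0[of F "z + 1"] deriv_shift_0[of F z] by (simp add: o_def)
  qed
  define q where "q = (\<lambda>z. if E z = 0 then deriv g z / deriv E z else g z / E z)"
  have z: "g z = 0" if "E z = 0" for z
  proof -
    have "z \<in> \<int>" using that by (simp add: E_def fourier_char_1_eq_1[symmetric])
    then obtain m where "z = of_int m" by (auto elim: Ints_cases)
    then show ?thesis using periodic_int[of g 0 m] per \<open>g 0 = 0\<close> by simp
  qed
  have s: "deriv E z \<noteq> 0" for z by (simp add: dE fourier_char_def)
  show ?thesis
  proof
    show "q holomorphic_on UNIV"
      unfolding q_def by (rule entire_quotient_simple_zeros(1)[OF hg hE z s])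
    show "g z = (1 - fourier_char 1 z) * q z" for z
      using entire_quotient_simple_zeros(2)[OF hg hE z s, of z] by (simp add: q_def E_def)
    show "q (z + 1) = q z" for z
      by (simp add: q_def Eper per dper[of E, OF Eper] dper[of g, OF per])
  qed
qed

text \<open>
  Shifting the segment of integration by \<open>\<epsilon> \<i>\<close>, with \<open>\<epsilon> = 1\<close> or \<open>\<epsilon> = -1\<close>, multiplies the character of
  index \<open>\<epsilon> n\<close> by a factor of modulus \<open>exp (- 2 \<pi>)^n\<close>. So the coefficients tend to zero in both
  directions, and a sequence of coefficients that is constant in one direction vanishes.
\<close>

lemma fourier_coefficient_decay:
  assumes "q holomorphic_on UNIV" and per: "\<And>z. q (z + 1) = q z" and "\<bar>\<epsilon>\<bar> = 1"
    and const: "\<And>n :: nat. period_integral (\<lambda>z. q z * fourier_char (\<epsilon> * int n) z) = c"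
  shows "c = 0"
proof -
  have "continuous_on (closed_segment 0 1) (\<lambda>t. q (t + of_int \<epsilon> * \<i>))"
    by (rule continuous_on_subset[OF holomorphic_on_imp_continuous_on[OF entire_translate[OF assms(1)]]]) simp
  then have "bounded ((\<lambda>t. q (t + of_int \<epsilon> * \<i>)) ` closed_segment 0 1)"
    by (intro compact_imp_bounded compact_continuous_image) auto
  then obtain B where "B > 0" "\<forall>y \<in> (\<lambda>t. q (t + of_int \<epsilon> * \<i>)) ` closed_segment 0 1. norm y \<le> B"
    unfolding bounded_pos by blast
  then have B: "B > 0" "\<And>t. t \<in> closed_segment 0 1 \<Longrightarrow> norm (q (t + of_int \<epsilon> * \<i>)) \<le> B"
    by auto
  have "\<epsilon> = 1 \<or> \<epsilon> = -1" using \<open>\<bar>\<epsilon>\<bar> = 1\<close> by linarith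
  then have \<epsilon>: "of_int \<epsilon> * of_int \<epsilon> = (1 :: real)" by auto
  have "norm c \<le> B * exp (- 2 * pi) ^ n" for n
    unfolding const[of n, symmetric]
  proof (rule period_integral_bound[where a = "of_int \<epsilon> * \<i>"])
    fix t :: complex assume t: "t \<in> closed_segment 0 1"
    then have "Im t = 0" by (auto simp: closed_segment_def)
    then have "norm (fourier_char (\<epsilon> * int n) (t + of_int \<epsilon> * \<i>)) = exp (- 2 * pi * n * (of_int \<epsilon> * of_int \<epsilon>))"
      by (simp add: norm_fourier_char mult_ac)
    then have "norm (fourier_char (\<epsilon> * int n) (t + of_int \<epsilon> * \<i>)) = exp (- 2 * pi) ^ n"
      unfolding \<epsilon> by (simp add: exp_of_nat_mult[symmetric] mult_ac)
    then show "norm (q (t + of_int \<epsilon> * \<i>) * fourier_char (\<epsilon> * int n) (t + of_int \<epsilon> * \<i>)) \<le> B * exp (- 2 * pi) ^ n"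
      using B(2)[OF t] by (simp add: norm_mult mult_right_mono)
  qed (use B assms in \<open>auto intro!: holomorphic_intros fourier_char_holomorphic simp: fourier_char_periodic\<close>)
  moreover have "(\<lambda>n. B * exp (- 2 * pi) ^ n) \<longlonglongrightarrow> B * 0"
    by (intro tendsto_intros LIMSEQ_power_zero) auto
  ultimately have "norm c \<le> B * 0"
    by (intro LIMSEQ_le_const[of _ _ "norm c"]) auto
  then show ?thesis by simp
qed

text \<open>
  Write \<open>f - f 0 = (1 - e) q\<close> with \<open>e\<close> the character of index 1. If all coefficients of \<open>f\<close> vanish, the
  coefficients \<open>b k\<close> of \<open>q\<close> satisfy \<open>b (k + 1) = b k\<close> except for the jump \<open>b 1 - b 0 = f 0\<close>. As
  they decay in both directions, both constant halves vanish, hence so does the jump.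
  This replaces an appeal to the convergence of Fourier series.
\<close>

lemma fourier_coefficients_zero_at_0:
  assumes hf: "f holomorphic_on UNIV" and per: "\<And>z. f (z + 1) = f z"
    and zero: "\<And>k. period_integral (\<lambda>z. f z * fourier_char k z) = 0"
  shows "f 0 = 0"
proof -
  obtain q where q: "q holomorphic_on UNIV" "\<And>z. q (z + 1) = q z"
    "\<And>z. f z - f 0 = (1 - fourier_char 1 z) * q z"
    by (rule periodic_quotient[of "\<lambda>z. f z - f 0"]) (auto intro!: holomorphic_intros hf simp: per)
  define b where "b k = period_integral (\<lambda>z. q z * fourier_char k z)" for k
  have hq: "(\<lambda>z. q z * fourier_char k z) holomorphic_on UNIV" for k
    by (intro holomorphic_intros q fourier_char_holomorphic)
  have rec: "f 0 * (if k = 0 then 1 else 0) + b k - b (k + 1) = 0" for k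
  proof -
    have fz: "f z = f 0 + (1 - fourier_char 1 z) * q z" for z using q(3)[of z] by (simp add: algebra_simps)
    have "0 = period_integral (\<lambda>z. f z * fourier_char k z)" using zero by simp
    also have "(\<lambda>z. f z * fourier_char k z) = (\<lambda>z. f 0 * fourier_char k z +
        (q z * fourier_char k z + (- 1) * (q z * fourier_char (k + 1) z)))"
      by (subst fz) (simp add: fourier_char_add algebra_simps fun_eq_iff)
    also have "period_integral \<dots> = f 0 * (if k = 0 then 1 else 0) + (b k + (- 1) * b (k + 1))"
      unfolding b_def by (subst period_integral_add period_integral_cmult;
        (intro holomorphic_intros hq fourier_char_holomorphic)?)+
        (simp add: period_integral_fourier_char)
    finally show ?thesis by (cases "k = 0") (simp_all add: algebra_simps)
  qed
  have "b (1 + int n) = b 1" for n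
  proof (induction n)
    case (Suc n) then show ?case using rec[of "1 + int n"] by (simp add: add_ac)
  qed simp
  then have "b 1 = 0"
    using fourier_coefficient_decay[of "\<lambda>z. q z * fourier_char 1 z" 1 "b 1"] hq[of 1] q(2)
    by (simp add: b_def mult.assoc fourier_char_add[symmetric] fourier_char_periodic)
  moreover have "b (- int n) = b 0" for n
  proof (induction n)
    case (Suc n) then show ?case using rec[of "- 1 - int n"] by (simp add: algebra_simps)
  qed simp
  then have "b 0 = 0"
    using fourier_coefficient_decay[of q "-1" "b 0"] q by (simp add: b_def)
  \<comment> \<open>At \<open>k = 0\<close> the recursion reads \<open>f 0 + b 0 - b 1 = 0\<close>.\<close>
  ultimately show ?thesis using rec[of 0] by simp
qed

lemma fourier_coefficients_zero:
  assumes hf: "f holomorphic_on UNIV" and per: "\<And>z. f (z + 1) = f z"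
    and zero: "\<And>k. period_integral (\<lambda>z. f z * fourier_char k z) = 0"
  shows "f s = 0"
proof -
  have "(\<lambda>z. f (z + s)) 0 = 0"
  proof (rule fourier_coefficients_zero_at_0)
    fix k
    have h: "(\<lambda>z. f z * fourier_char k z) holomorphic_on UNIV"
      by (intro holomorphic_intros hf fourier_char_holomorphic)
    have "0 = period_integral (\<lambda>z. f (z + s) * fourier_char k (z + s))"
      using period_integral_translate[OF h, of s] zero[of k] per fourier_char_periodic by simp
    also have "\<dots> = period_integral (\<lambda>z. fourier_char k s * (f (z + s) * fourier_char k z))"
      by (simp add: fourier_char_translate mult_ac)
    also have "\<dots> = fourier_char k s * period_integral (\<lambda>z. f (z + s) * fourier_char k z)"
      by (intro period_integral_cmult holomorphic_intros entire_translate hf fourier_char_holomorphic)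
    finally show "period_integral (\<lambda>z. f (z + s) * fourier_char k z) = 0"
      by (simp add: fourier_char_def)
  qed (use per[of "z + s" for z] in \<open>auto intro: entire_translate hf simp: add_ac\<close>)
  then show ?thesis by simp
qed

text \<open>
  Three vectors in a plane are dependent: the cross product of the two rows gives the coefficients,
  unless it vanishes, in which case the rows are parallel.
\<close>

lemma dependent_pair_of_functionals:
  fixes p1 p2 p3 q1 q2 q3 :: "'a :: field"
  obtains c1 c2 c3 where "(c1, c2, c3) \<noteq> (0, 0, 0)"
    "c1 * p1 + c2 * p2 + c3 * p3 = 0" "c1 * q1 + c2 * q2 + c3 * q3 = 0"
proof (cases "(p2 * q3 - p3 * q2, p3 * q1 - p1 * q3, p1 * q2 - p2 * q1) = (0, 0, 0)")
  case False
  show ?thesis by (rule that[OF False]) (simp_all add: algebra_simps)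
next
  case True
  then have par: "p2 * q3 = p3 * q2" "p3 * q1 = p1 * q3" "p1 * q2 = p2 * q1" by auto
  consider "p1 = 0" "q1 = 0" | "p1 \<noteq> 0" | "q1 \<noteq> 0" by blast
  then show ?thesis
  proof cases
    case 1 then show ?thesis using that[of 1 0 0] by simp
  next
    case 2 then show ?thesis using that[of "- p2" p1 0] par by (simp add: mult.commute)
  next
    case 3 then show ?thesis using that[of "- q2" q1 0] par by (simp add: mult.commute)
  qed
qed

section \<open>The three-term relation of the theta function\<close>

lemma two_step_recursion_zero:
  fixes c :: "int \<Rightarrow> complex"
  assumes "\<And>k. c k = 0 \<longleftrightarrow> c (k - 2) = 0" "c 0 = 0" "c 1 = 0"
  shows "c k = 0"
proof -
  have "c (2 * m + r) = 0 \<longleftrightarrow> c r = 0" for m r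
  proof (induction m rule: int_induct[where k = 0])
    case (step1 i) then show ?case using assms(1)[of "2 * (i + 1) + r"] by (simp add: algebra_simps)
  next
    case (step2 i) then show ?case using assms(1)[of "2 * i + r"] by (simp add: algebra_simps)
  qed simp
  from this[of "k div 2" "k mod 2"] assms(2,3) show ?thesis
    by (cases "even k") (auto simp: odd_iff_mod_2_eq_one even_iff_mod_2_eq_zero)
qed

text \<open>
  Translation by \<open>\<tau>\<close> relates the Fourier coefficients of index \<open>k\<close> and \<open>k - 2\<close> by a nonzero factor, so
  a theta function of degree two is determined by two of its coefficients.
\<close>

lemma theta_degree_2_zero:
  assumes hf: "f holomorphic_on UNIV" and per: "\<And>z. f (z + 1) = f z"
    and tau: "\<And>z. f (z + \<tau>) = C * (f z * fourier_char (- 2) z)" and "C \<noteq> 0"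
    and zero: "period_integral (\<lambda>z. f z * fourier_char 0 z) = 0"
      "period_integral (\<lambda>z. f z * fourier_char 1 z) = 0"
  shows "f s = 0"
proof (rule fourier_coefficients_zero[OF hf per])
  have hc: "(\<lambda>z. f z * fourier_char k z) holomorphic_on UNIV" for k
    by (intro holomorphic_intros hf fourier_char_holomorphic)
  have "period_integral (\<lambda>z. f z * fourier_char k z) =
      C * fourier_char k \<tau> * period_integral (\<lambda>z. f z * fourier_char (k - 2) z)" for k
  proof -
    have "period_integral (\<lambda>z. f z * fourier_char k z) = period_integral (\<lambda>z. f (z + \<tau>) * fourier_char k (z + \<tau>))"
      using period_integral_translate[OF hc, where a = \<tau>] per fourier_char_periodic by simp
    also have "\<dots> = period_integral (\<lambda>z. (C * fourier_char k \<tau>) * (f z * fourier_char (k - 2) z))"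
      using fourier_char_add[of k "- 2"] by (simp add: tau fourier_char_translate mult_ac fun_eq_iff)
    finally have "period_integral (\<lambda>z. f z * fourier_char k z) =
        period_integral (\<lambda>z. (C * fourier_char k \<tau>) * (f z * fourier_char (k - 2) z))" .
    then show ?thesis by (simp only: period_integral_cmult[OF hc])
  qed
  then have "period_integral (\<lambda>z. f z * fourier_char k z) = 0 \<longleftrightarrow>
      period_integral (\<lambda>z. f z * fourier_char (k - 2) z) = 0" for k
    using \<open>C \<noteq> 0\<close> by (simp add: fourier_char_def)
  from two_step_recursion_zero[OF this zero]
  show "period_integral (\<lambda>z. f z * fourier_char k z) = 0" for k .
qed

text \<open>
  The space of theta functions of degree two with fixed multiplier is at most two-dimensional.
\<close>

lemma theta_degree_2_dependent:
  assumes hol: "f1 holomorphic_on UNIV" "f2 holomorphic_on UNIV" "f3 holomorphic_on UNIV"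
    and per: "\<And>z. f1 (z + 1) = f1 z" "\<And>z. f2 (z + 1) = f2 z" "\<And>z. f3 (z + 1) = f3 z"
    and tau: "\<And>z. f1 (z + \<tau>) = C * (f1 z * fourier_char (- 2) z)"
      "\<And>z. f2 (z + \<tau>) = C * (f2 z * fourier_char (- 2) z)"
      "\<And>z. f3 (z + \<tau>) = C * (f3 z * fourier_char (- 2) z)" and "C \<noteq> 0"
  obtains c1 c2 c3 where "(c1, c2, c3) \<noteq> (0, 0, 0)"
    "\<And>z. c1 * f1 z + c2 * f2 z + c3 * f3 z = 0"
proof -
  define a where "a f k = period_integral (\<lambda>z. f z * fourier_char k z)" for f k
  obtain c1 c2 c3 where c: "(c1, c2, c3) \<noteq> (0, 0, 0)"
    "c1 * a f1 0 + c2 * a f2 0 + c3 * a f3 0 = 0" "c1 * a f1 1 + c2 * a f2 1 + c3 * a f3 1 = 0"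
    by (rule dependent_pair_of_functionals)
  define g where "g = (\<lambda>z. c1 * f1 z + c2 * f2 z + c3 * f3 z)"
  have "a g k = c1 * a f1 k + c2 * a f2 k + c3 * a f3 k" for k
  proof -
    have "a g k = period_integral (\<lambda>z. (c1 * (f1 z * fourier_char k z) +
        c2 * (f2 z * fourier_char k z)) + c3 * (f3 z * fourier_char k z))"
      by (simp add: a_def g_def algebra_simps)
    also have "\<dots> = (c1 * a f1 k + c2 * a f2 k) + c3 * a f3 k"
      unfolding a_def by (subst period_integral_add period_integral_cmult;
        (intro holomorphic_intros hol fourier_char_holomorphic)?)+ simp
    finally show ?thesis .
  qed
  then have "a g 0 = 0" "a g 1 = 0" using c by auto
  then have "g z = 0" for z
    by (intro theta_degree_2_zero[of g \<tau> C])
       (auto simp: a_def g_def per tau algebra_simps intro!: holomorphic_intros hol \<open>C \<noteq> 0\<close>)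
  then show ?thesis using that[OF c(1)] by (simp add: g_def)
qed

text \<open>
  The exponential factor turns \<open>\<theta>\<close> into an odd function, for which the three-term relation carries no
  exponential factors. The price is that it is periodic only up to sign.
\<close>

definition odd_theta :: "(complex \<Rightarrow> complex) \<Rightarrow> complex \<Rightarrow> complex" where
  "odd_theta \<theta> z = exp (- (of_real pi * \<i> * z)) * \<theta> z"

lemma theta_eq_odd_theta: "\<theta> z = exp (of_real pi * \<i> * z) * odd_theta \<theta> z"
  by (simp add: odd_theta_def exp_minus)

lemma odd_theta_minus:
  assumes "theta_order1 \<tau> \<theta>"
  shows "odd_theta \<theta> (- z) = - odd_theta \<theta> z"
proof -
  have "\<theta> (- z) = - exp (- 2 * of_real pi * \<i> * z) * \<theta> z"
    using assms by (simp add: theta_order1_def)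
  moreover have "exp (of_real pi * \<i> * z) * exp (- 2 * of_real pi * \<i> * z) = exp (- (of_real pi * \<i> * z))"
    by (simp add: exp_add[symmetric] algebra_simps)
  ultimately show ?thesis by (simp add: odd_theta_def)
qed

lemma theta_add_tau:
  assumes "theta_order1 \<tau> \<theta>"
  shows "\<theta> (z + \<tau>) = - exp (- 2 * of_real pi * \<i> * z) * \<theta> z"
  using assms by (simp add: theta_order1_def)

text \<open>
  When \<open>odd_theta \<theta>\<close> is odd, this pairing is antisymmetric, and as a function of \<open>a\<close> it lies in a space of dimension
  two that does not depend on \<open>b\<close>. So it behaves like a determinant of two vectors in a plane.
\<close>

definition theta_bracket :: "(complex \<Rightarrow> complex) \<Rightarrow> complex \<Rightarrow> complex \<Rightarrow> complex" where
  "theta_bracket \<theta> a b = odd_theta \<theta> (a + b) * odd_theta \<theta> (a - b)"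

lemma theta_bracket_antisym:
  assumes "theta_order1 \<tau> \<theta>"
  shows "theta_bracket \<theta> b a = - theta_bracket \<theta> a b"
  using odd_theta_minus[OF assms, of "a - b"] by (simp add: theta_bracket_def add.commute)

lemma theta_bracket_eq:
  "theta_bracket \<theta> z x = fourier_char (- 1) z * (\<theta> (z + x) * \<theta> (z - x))"
proof -
  have "exp (- (of_real pi * \<i> * (z + x))) * exp (- (of_real pi * \<i> * (z - x))) = fourier_char (- 1) z"
    by (simp add: fourier_char_def exp_add[symmetric] algebra_simps)
  then show ?thesis by (simp add: theta_bracket_def odd_theta_def mult_ac)
qed

lemma theta_bracket_theta_degree_2:
  assumes "theta_order1 \<tau> \<theta>"
  shows "(\<lambda>z. theta_bracket \<theta> z x) holomorphic_on UNIV"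
    "theta_bracket \<theta> (z + 1) x = theta_bracket \<theta> z x"
    "theta_bracket \<theta> (z + \<tau>) x = fourier_char (- 1) \<tau> * (theta_bracket \<theta> z x * fourier_char (- 2) z)"
proof -
  have h: "\<theta> holomorphic_on UNIV" and per: "\<And>z. \<theta> (z + 1) = \<theta> z"
    using assms by (auto simp: theta_order1_def)
  show "(\<lambda>z. theta_bracket \<theta> z x) holomorphic_on UNIV"
    unfolding theta_bracket_eq
    using entire_translate[OF h, of x] entire_translate[OF h, of "- x"]
    by (intro holomorphic_intros fourier_char_holomorphic) auto
  show "theta_bracket \<theta> (z + 1) x = theta_bracket \<theta> z x"
  proof -
    have "z + 1 + x = z + x + 1" "z + 1 - x = z - x + 1" by simp_all
    then show ?thesis by (simp only: theta_bracket_eq per fourier_char_periodic)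
  qed
  have "\<theta> (z + \<tau> + x) * \<theta> (z + \<tau> - x) = fourier_char (- 2) z * (\<theta> (z + x) * \<theta> (z - x))"
  proof -
    have "exp (- 2 * of_real pi * \<i> * (z + x)) * exp (- 2 * of_real pi * \<i> * (z - x)) = fourier_char (- 2) z"
      by (simp add: fourier_char_def exp_add[symmetric] algebra_simps)
    moreover have "\<theta> (z + \<tau> + x) * \<theta> (z + \<tau> - x) = 
      (exp (- 2 * of_real pi * \<i> * (z + x)) * exp (- 2 * of_real pi * \<i> * (z - x))) * (\<theta> (z + x) * \<theta> (z - x))"
    proof -
      have "z + \<tau> + x = z + x + \<tau>" "z + \<tau> - x = z - x + \<tau>" by simp_all
      then show ?thesis by (simp only: theta_add_tau[OF assms]) simp
    qed
    ultimately show ?thesis by simp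
  qed
  then show "theta_bracket \<theta> (z + \<tau>) x = fourier_char (- 1) \<tau> * (theta_bracket \<theta> z x * fourier_char (- 2) z)"
    by (simp add: theta_bracket_eq fourier_char_translate mult_ac)
qed

text \<open>
  The three functions \<open>[z, x]\<close>, \<open>[z, v]\<close>, \<open>[z, w]\<close> of \<open>z\<close> are linearly dependent. Evaluating a dependency
  at \<open>z = x\<close>, \<open>v\<close>, \<open>w\<close> shows that its coefficients are proportional to \<open>[v, w]\<close>, \<open>[w, x]\<close>, \<open>[x, v]\<close>,
  and the relation is the dependency at \<open>z = u\<close>.
\<close>

lemma theta_bracket_Pluecker:
  assumes th: "theta_order1 \<tau> \<theta>"
  shows "theta_bracket \<theta> u x * theta_bracket \<theta> v w + theta_bracket \<theta> u v * theta_bracket \<theta> w x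
    + theta_bracket \<theta> u w * theta_bracket \<theta> x v = 0"
proof -
  let ?b = "theta_bracket \<theta>"
  note deg = theta_bracket_theta_degree_2[OF th]
  obtain c1 c2 c3 where c: "(c1, c2, c3) \<noteq> (0, 0, 0)"
    and dep: "\<And>z. c1 * ?b z x + c2 * ?b z v + c3 * ?b z w = 0"
    by (rule theta_degree_2_dependent[OF deg(1) deg(1) deg(1) deg(2) deg(2) deg(2) deg(3) deg(3) deg(3)])
       (auto simp: fourier_char_def)
  have anti: "?b a b = - ?b b a" for a b by (rule theta_bracket_antisym[OF th])
  have self: "?b a a = 0" for a using anti[of a a] by simp
  have 1: "c2 * ?b x v = c3 * ?b w x" using dep[of x] anti[of x w] by (simp add: self)
  have 2: "c1 * ?b x v = c3 * ?b v w" using dep[of v] anti[of v x] by (simp add: self)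
  have 3: "c1 * ?b w x = c2 * ?b v w" using dep[of w] anti[of w v] by (simp add: self)
  consider "c1 \<noteq> 0" | "c2 \<noteq> 0" | "c3 \<noteq> 0" using c by auto
  then show ?thesis
  proof cases
    case 1
    have "c1 * (?b u x * ?b v w + ?b u v * ?b w x + ?b u w * ?b x v) =
        c1 * ?b u x * ?b v w + ?b u v * (c1 * ?b w x) + ?b u w * (c1 * ?b x v)" by (simp add: algebra_simps)
    also have "\<dots> = ?b v w * (c1 * ?b u x + c2 * ?b u v + c3 * ?b u w)"
      unfolding 2 3 by (simp add: algebra_simps)
    finally show ?thesis using dep 1 by simp
  next
    case 2
    have "c2 * (?b u x * ?b v w + ?b u v * ?b w x + ?b u w * ?b x v) =
        ?b u x * (c2 * ?b v w) + c2 * ?b u v * ?b w x + ?b u w * (c2 * ?b x v)" by (simp add: algebra_simps)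
    also have "\<dots> = ?b w x * (c1 * ?b u x + c2 * ?b u v + c3 * ?b u w)"
      unfolding 1 3[symmetric] by (simp add: algebra_simps)
    finally show ?thesis using dep 2 by simp
  next
    case 3
    have "c3 * (?b u x * ?b v w + ?b u v * ?b w x + ?b u w * ?b x v) =
        ?b u x * (c3 * ?b v w) + ?b u v * (c3 * ?b w x) + c3 * ?b u w * ?b x v" by (simp add: algebra_simps)
    also have "\<dots> = ?b x v * (c1 * ?b u x + c2 * ?b u v + c3 * ?b u w)"
      unfolding 1[symmetric] 2[symmetric] by (simp add: algebra_simps)
    finally show ?thesis using dep 3 by simp
  qed
qed

text \<open>
  With \<open>p = a + b\<close>, \<open>q = a - b\<close>, \<open>r = a + c\<close>, \<open>t = a + e\<close> this is the symmetric relation between the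
  brackets of \<open>a, b, c, e\<close>; the present variables avoid half-sums in the applications.
\<close>

locale three_term =
  fixes s :: "complex \<Rightarrow> complex"
  assumes odd: "s (- a) = - s a"
    and relation: "s p * s q * s (r + t - p - q) * s (r - t) + s r * s (p + q - r) * s (t - q) * s (t - p)
      + s t * s (p + q - t) * s (r - q) * s (p - r) = 0"

lemma three_term_odd_theta:
  assumes th: "theta_order1 \<tau> \<theta>"
  shows "three_term (odd_theta \<theta>)"
proof
  fix p q r t :: complex
  define a where "a = (p + q) / 2"
  define b where "b = (p - q) / 2"
  define c where "c = r - (p + q) / 2"
  define e where "e = t - (p + q) / 2"
  have "a + b = p" "a - b = q" "c + e = r + t - p - q" "c - e = r - t"
    "a + c = r" "a - c = p + q - r" "e + b = t - q" "e - b = t - p"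
    "a + e = t" "a - e = p + q - t" "b + c = r - q" "b - c = p - r"
    unfolding a_def b_def c_def e_def by (simp_all add: field_simps)
  then show "odd_theta \<theta> p * odd_theta \<theta> q * odd_theta \<theta> (r + t - p - q) * odd_theta \<theta> (r - t) +
      odd_theta \<theta> r * odd_theta \<theta> (p + q - r) * odd_theta \<theta> (t - q) * odd_theta \<theta> (t - p)
      + odd_theta \<theta> t * odd_theta \<theta> (p + q - t) * odd_theta \<theta> (r - q) * odd_theta \<theta> (p - r) = 0"
    using theta_bracket_Pluecker[OF th, of a b c e] by (simp add: theta_bracket_def mult.assoc)
qed (rule odd_theta_minus[OF th])

section \<open>Exchange relations for the factors of a coefficient\<close>

text \<open>
  The coordinates of one level after a generator \<open>e\<^sub>i\<close> of that level has moved past them.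
\<close>

definition shifted_coord :: "complex \<Rightarrow> (nat \<Rightarrow> complex) \<Rightarrow> nat \<Rightarrow> nat \<Rightarrow> complex" where
  "shifted_coord h z i j = (if j = i then z j else z j - h)"

text \<open>
  In the product of the elements at \<open>u\<close> and \<open>v\<close> let \<open>i\<close> be the index chosen at some level by the first
  factor, and \<open>j\<close> the one chosen by the second factor, whose variables are shifted. The functions
  \<open>left_wt\<close>, \<open>link_wt\<close> and \<open>right_wt\<close> collect the theta factors that belong to the first level, to two
  adjacent levels (capital letters for the second of them), and to the last level.
\<close>

definition left_wt where
  "left_wt f h z u v i j = f (u - z i) * f (v - shifted_coord h z i j)"

definition right_wt where
  "right_wt f h z u v i j = f (u + z i) * f (v + shifted_coord h z i j)"

definition link_wt where
  "link_wt f h z Z t u v i j I J =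
     (f (u + z i - Z I) * f (z i + Z I - t)) *
     (f (v + shifted_coord h z i j - shifted_coord h Z I J) *
      f (shifted_coord h z i j + shifted_coord h Z I J - (t - h)))"

text \<open>
  The two kinds of entries of the elliptic dynamical \<open>R\<close>-matrix with spectral parameter \<open>w\<close>, acting on
  the states \<open>(i, j)\<close> and \<open>(j, i)\<close>, without its common denominator \<open>s (w - h)\<close>. The case \<open>i = j\<close> is the
  value at \<open>z j = z i + h\<close> of the general formula when \<open>s h\<close> is not zero. This is consistent with \<open>shifted_coord\<close>, because
  \<open>z j - h\<close> then is \<open>z i\<close>.
\<close>

definition exch_diag where
  "exch_diag s h w z i j = (if i = j then s (w - h) else - (s h * s (w + (z i - z j))) / s (z i - z j))"

definition exch_off where
  "exch_off s h w z i j = (if i = j then 0 else s (z i - z j + h) * s w / s (z i - z j))"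

context three_term
begin

text \<open>
  A three-term relation in which the dynamical variable \<open>x - y\<close>, the spectral variable \<open>u - v\<close> and the
  step \<open>h\<close> separate; the coefficients on the two sides are the entries of the \<open>R\<close>-matrix.
\<close>

lemma exchange_identity:
  "s (x - y) * s (u - v - h) * s (v - x) * s (u - y + h) =
   - (s h * s (u - v + (x - y))) * s (u - x) * s (v - y + h) + s (x - y + h) * s (u - v) * s (u - y) * s (v - x + h)"
  using relation[of "x - y" "u - v - h" "u - y" "- h"]
    odd[of "v - x + h"] odd[of "u - v"] odd[of "x - y + h"] odd[of h] odd[of "u - x"]
  by (simp add: algebra_simps)

text \<open>
  This and the next relation are the two halves of the exchange relation between adjacent levels: the
  spectral parameters occur only here, \<open>h\<close> and \<open>t\<close> only there, and both produce the factor
  \<open>s (x - y - (X - Y))\<close>.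
\<close>

lemma link_identity_spectral:
  "s (x - y) * s (u - v + (X - Y)) * s (u + x - X) * s (v + y - Y) -
   s (X - Y) * s (u - v + (x - y)) * s (v + x - X) * s (u + y - Y) =
   s (u - v) * s (x - y - (X - Y)) * s (u + x - Y) * s (v + y - X)"
  using relation[of "x - y" "X - Y + u - v" "u + x - Y" "x - y + u - v"]
    odd[of "x - y - (X - Y)"] odd[of "v + y - Y"] odd[of "v + y - X"] odd[of "u + y - Y"]  odd[of "v + x - X"]
  by (simp add: algebra_simps)

lemma link_identity_tail:
  "s (x - y) * s (X - Y + h) * s (x + Y - t) * s (y + X - h - t) -
   s (X - Y) * s (x - y + h) * s (y + X - t) * s (x + Y - h - t) =
   s h * s (x - y - (X - Y)) * s (x + X - t) * s (y + Y - h - t)"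
  using relation[of "x - y" "X - Y + h" "x + X - t" "x - y + h"]
    odd[of "x - y - (X - Y)"] odd[of "y + Y - h - t"] odd[of "y + X - h - t"] odd[of "y + X - t"] odd[of h]
   odd[of "x + Y - t"] odd[of "x + Y - h - t"]
  by (simp add: algebra_simps)

lemma left_exchange:
  assumes "i \<noteq> j \<Longrightarrow> s (z i - z j) \<noteq> 0"
  shows "s (u - v - h) * left_wt s h z v u i j =
    exch_diag s h (u - v) z i j * left_wt s h z u v i j + exch_off s h (u - v) z i j * left_wt s h z u v j i"
proof (cases "i = j")
  case True
  then show ?thesis by (simp add: left_wt_def exch_diag_def exch_off_def shifted_coord_def)
next
  case False
  then have nz: "s (z i - z j) \<noteq> 0" by (rule assms)
  have "s (z i - z j) * (s (u - v - h) * left_wt s h z v u i j) =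
    s (z i - z j) * s (u - v - h) * s (v - z i) * s (u - z j + h)"
    using False by (simp add: left_wt_def shifted_coord_def diff_diff_eq2 diff_add_eq)
  also have "\<dots> = s (z i - z j) * (exch_diag s h (u - v) z i j * left_wt s h z u v i j +
      exch_off s h (u - v) z i j * left_wt s h z u v j i)"
    unfolding exchange_identity using False nz
    by (simp add: left_wt_def shifted_coord_def diff_diff_eq2 diff_add_eq exch_diag_def exch_off_def field_simps)
  finally show ?thesis using nz by simp
qed

text \<open>
  Reflection reduces the last level to the first one: the exchange relation of the first level at
  \<open>(- v, - u)\<close>, where the difference is still \<open>u - v\<close>, becomes one for the last level, with the roles of
  \<open>u\<close> and \<open>v\<close> reversed.
\<close>

lemma right_wt_eq_left_wt: "right_wt s h z u v i j = left_wt s h z (- u) (- v) i j"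
  using odd[of "u + z i"] odd[of "v + shifted_coord h z i j"]
  by (simp add: right_wt_def left_wt_def add.commute)

lemma right_exchange:
  assumes "i \<noteq> j \<Longrightarrow> s (z i - z j) \<noteq> 0"
  shows "s (u - v - h) * right_wt s h z u v i j =
    exch_diag s h (u - v) z i j * right_wt s h z v u i j + exch_off s h (u - v) z i j * right_wt s h z v u j i"
  using left_exchange[where u = "- v" and v = "- u" and i = i and j = j and z = z and h = h] assms
  unfolding right_wt_eq_left_wt by simp

text \<open>
  The matrix of weights between two levels intertwines the \<open>R\<close>-matrices of these levels. If exactly one of the
  levels has \<open>i = j\<close>, the factors with \<open>t\<close> are common to all terms and the relation reduces to that for
  a single level with shifted spectral parameters.
\<close>

lemma link_exchange:
  assumes "i \<noteq> j \<Longrightarrow> s (z i - z j) \<noteq> 0" and "I \<noteq> J \<Longrightarrow> s (Z I - Z J) \<noteq> 0"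
  shows "exch_diag s h (u - v) z i j * link_wt s h z Z t v u i j I J +
      exch_off s h (u - v) z i j * link_wt s h z Z t v u j i I J =
    exch_diag s h (u - v) Z I J * link_wt s h z Z t u v i j I J +
      exch_off s h (u - v) Z I J * link_wt s h z Z t u v i j J I"
proof (cases "i = j"; cases "I = J")
  assume "i = j" "I = J"
  then show ?thesis
    by (simp add: link_wt_def exch_diag_def exch_off_def shifted_coord_def)
next
  assume e: "i = j" "I \<noteq> J"
  have t: "z i + (Z K - h) - (t - h) = z i + Z K - t" for K by simp
  have "s (u - v - h) * left_wt s h Z (v + z i) (u + z i) I J * (s (z i + Z I - t) * s (z i + Z J - t)) =
    (exch_diag s h (u - v) Z I J * left_wt s h Z (u + z i) (v + z i) I J +
      exch_off s h (u - v) Z I J * left_wt s h Z (u + z i) (v + z i) J I) * (s (z i + Z I - t) * s (z i + Z J - t))"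
    using left_exchange[of I J Z "u + z i" "v + z i" h, OF assms(2)] by simp
  then show ?thesis using e
    by (simp add: link_wt_def left_wt_def exch_diag_def[of s h "u - v" z] exch_off_def[of s h "u - v" z] shifted_coord_def t algebra_simps)
next
  assume e: "i \<noteq> j" "I = J"
  have "s (u - v - h) * right_wt s h z (u - Z I) (v - Z I) i j * (s (z i + Z I - t) * s (z j + Z I - t)) =
    (exch_diag s h (u - v) z i j * right_wt s h z (v - Z I) (u - Z I) i j +
      exch_off s h (u - v) z i j * right_wt s h z (v - Z I) (u - Z I) j i) * (s (z i + Z I - t) * s (z j + Z I - t))"
    using right_exchange[of i j z "u - Z I" "v - Z I" h, OF assms(1)] by simp
  then show ?thesis using e
    by (simp add: link_wt_def right_wt_def exch_diag_def[of s h "u - v" Z] exch_off_def[of s h "u - v" Z] shifted_coord_def algebra_simps)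
next
  assume e: "i \<noteq> j" "I \<noteq> J"
  then have nz: "s (z i - z j) \<noteq> 0" "s (Z I - Z J) \<noteq> 0" using assms by auto
  define w where "w = u - v"
  define d where "d = z i - z j"
  define D where "D = Z I - Z J"
  define T where "T = s (z i + Z I - t) * s (z j + Z J - h - t)"
  define T2 where "T2 = s (z j + Z I - t) * s (z i + Z J - h - t)"
  define T3 where "T3 = s (z i + Z J - t) * s (z j + Z I - h - t)"
  define S where "S = s (u + z i - Z I) * s (v + z j - Z J)"
  define S2 where "S2 = s (v + z i - Z I) * s (u + z j - Z J)"
  define S3 where "S3 = s (u + z i - Z J) * s (v + z j - Z I)"
  have K: "link_wt s h z Z t v u i j I J = S2 * T" "link_wt s h z Z t v u j i I J = S3 * T2"
    "link_wt s h z Z t u v i j I J = S * T" "link_wt s h z Z t u v i j J I = S3 * T3"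
    using e unfolding link_wt_def shifted_coord_def T_def T2_def T3_def S_def S2_def S3_def
    by (simp_all add: algebra_simps)
  have 1: "s d * s (w + D) * S - s D * s (w + d) * S2 = s w * s (d - D) * S3"
    using link_identity_spectral[of "z i" "z j" u v "Z I" "Z J"]
    by (simp add: d_def D_def w_def S_def S2_def S3_def mult.assoc)
  have 2: "s d * s (D + h) * T3 - s D * s (d + h) * T2 = s h * s (d - D) * T"
    using link_identity_tail[of "z i" "z j" "Z I" "Z J" h t]
    by (simp add: d_def D_def T_def T2_def T3_def mult.assoc)
  \<comment> \<open>Both sides equal \<open>s h * T * (s w * s (d - D) * S3)\<close>.\<close>
  have "s h * T * (s d * s (w + D) * S - s D * s (w + d) * S2) =
    s w * S3 * (s d * s (D + h) * T3 - s D * s (d + h) * T2)" unfolding 1 2 by simp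
  then have "s D * (- (s h * s (w + d)) * (S2 * T) + s (d + h) * s w * (S3 * T2)) =
      s d * (- (s h * s (w + D)) * (S * T) + s (D + h) * s w * (S3 * T3))"
    by (simp add: algebra_simps)
  then show ?thesis
    using nz e unfolding K exch_diag_def exch_off_def d_def[symmetric] D_def[symmetric] w_def[symmetric]
    by (simp add: field_simps)
qed

end

section \<open>Transferring exchange relations along a path\<close>

text \<open>
  The weight of a pair of paths: a factor \<open>L\<close> for the start, \<open>G\<close> for every level and \<open>K\<close> for every
  step from one level to the next.
\<close>

definition path_wt ::
    "(nat \<Rightarrow> nat \<Rightarrow> 'r) \<Rightarrow> (nat \<Rightarrow> nat \<Rightarrow> nat \<Rightarrow> 'r) \<Rightarrow> (nat \<Rightarrow> nat \<Rightarrow> nat \<Rightarrow> nat \<Rightarrow> nat \<Rightarrow> 'r) \<Rightarrow>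
     nat \<Rightarrow> (nat \<Rightarrow> nat) \<Rightarrow> (nat \<Rightarrow> nat) \<Rightarrow> 'r :: comm_ring_1" where
  "path_wt L G K N \<alpha> \<beta> = L (\<alpha> 1) (\<beta> 1) * (\<Prod>\<gamma>=1..N. G \<gamma> (\<alpha> \<gamma>) (\<beta> \<gamma>)) *
     (\<Prod>\<gamma>=1..N - 1. K \<gamma> (\<alpha> \<gamma>) (\<beta> \<gamma>) (\<alpha> (\<gamma> + 1)) (\<beta> (\<gamma> + 1)))"

text \<open>
  The function \<open>\<phi>\<close> of the last state stands for everything that is still to come, which makes an
  induction on the number of levels possible.
\<close>

definition path_sum where
  "path_sum S L G K N \<phi> = (\<Sum>\<alpha>\<in>Pi\<^sub>E {1..N} S. \<Sum>\<beta>\<in>Pi\<^sub>E {1..N} S. path_wt L G K N \<alpha> \<beta> * \<phi> (\<alpha> N) (\<beta> N))"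

lemma sum_PiE_Suc:
  fixes f :: "(nat \<Rightarrow> 'a) \<Rightarrow> 'b :: comm_monoid_add"
  shows "(\<Sum>\<alpha>\<in>Pi\<^sub>E {1..Suc N} S. f \<alpha>) = (\<Sum>\<alpha>\<in>Pi\<^sub>E {1..N} S. \<Sum>i\<in>S (Suc N). f (\<alpha>(Suc N := i)))"
proof -
  have "{1..Suc N} = insert (Suc N) {1..N}" by auto
  then have "(\<Sum>\<alpha>\<in>Pi\<^sub>E {1..Suc N} S. f \<alpha>) =
      (\<Sum>(i, \<alpha>)\<in>S (Suc N) \<times> Pi\<^sub>E {1..N} S. f (\<alpha>(Suc N := i)))"
    unfolding \<open>{1..Suc N} = _\<close> PiE_insert_eq
    by (subst sum.reindex[OF inj_combinator]) (auto simp: case_prod_unfold o_def)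
  also have "\<dots> = (\<Sum>i\<in>S (Suc N). \<Sum>\<alpha>\<in>Pi\<^sub>E {1..N} S. f (\<alpha>(Suc N := i)))"
    by (simp add: sum.cartesian_product)
  finally show ?thesis by (simp add: sum.swap[of _ "S (Suc N)"])
qed

lemma path_sum_1:
  "path_sum S L G K (Suc 0) \<phi> = (\<Sum>i\<in>S 1. \<Sum>j\<in>S 1. L i j * G 1 i j * \<phi> i j)"
proof -
  have "(\<Sum>\<alpha>\<in>Pi\<^sub>E {1..Suc 0} S. f \<alpha>) = (\<Sum>i\<in>S 1. f ((\<lambda>_. undefined)(1 := i)))"
    for f :: "(nat \<Rightarrow> nat) \<Rightarrow> 'a"
    by (subst sum_PiE_Suc) (simp add: fun_upd_def)
  then show ?thesis by (simp add: path_sum_def path_wt_def)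
qed

lemma path_wt_Suc:
  assumes "N \<ge> 1"
  shows "path_wt L G K (Suc N) (\<alpha>(Suc N := I)) (\<beta>(Suc N := J)) =
    path_wt L G K N \<alpha> \<beta> * (K N (\<alpha> N) (\<beta> N) I J * G (Suc N) I J)"
proof -
  obtain M where M: "N = Suc M" using assms by (cases N) auto
  have "(\<Prod>\<gamma>=1..N. G \<gamma> ((\<alpha>(Suc N := I)) \<gamma>) ((\<beta>(Suc N := J)) \<gamma>)) = (\<Prod>\<gamma>=1..N. G \<gamma> (\<alpha> \<gamma>) (\<beta> \<gamma>))"
    by (intro prod.cong) auto
  moreover have "(\<Prod>\<gamma>=1..M. K \<gamma> ((\<alpha>(Suc N := I)) \<gamma>) ((\<beta>(Suc N := J)) \<gamma>)
        ((\<alpha>(Suc N := I)) (\<gamma> + 1)) ((\<beta>(Suc N := J)) (\<gamma> + 1))) =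
      (\<Prod>\<gamma>=1..M. K \<gamma> (\<alpha> \<gamma>) (\<beta> \<gamma>) (\<alpha> (\<gamma> + 1)) (\<beta> (\<gamma> + 1)))"
    by (intro prod.cong) (auto simp: M)
  ultimately show ?thesis by (simp add: path_wt_def M mult_ac)
qed

lemma path_sum_Suc:
  assumes "N \<ge> 1"
  shows "path_sum S L G K (Suc N) \<phi> = path_sum S L G K N
    (\<lambda>i j. \<Sum>I\<in>S (Suc N). \<Sum>J\<in>S (Suc N). K N i j I J * G (Suc N) I J * \<phi> I J)"
proof -
  have "path_sum S L G K (Suc N) \<phi> = (\<Sum>\<alpha>\<in>Pi\<^sub>E {1..N} S. \<Sum>I\<in>S (Suc N). \<Sum>\<beta>\<in>Pi\<^sub>E {1..N} S. \<Sum>J\<in>S (Suc N).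
      path_wt L G K N \<alpha> \<beta> * (K N (\<alpha> N) (\<beta> N) I J * G (Suc N) I J) * \<phi> I J)"
    unfolding path_sum_def sum_PiE_Suc path_wt_Suc[OF assms] by simp
  also have "\<dots> = (\<Sum>\<alpha>\<in>Pi\<^sub>E {1..N} S. \<Sum>\<beta>\<in>Pi\<^sub>E {1..N} S. \<Sum>I\<in>S (Suc N). \<Sum>J\<in>S (Suc N).
      path_wt L G K N \<alpha> \<beta> * (K N (\<alpha> N) (\<beta> N) I J * G (Suc N) I J) * \<phi> I J)"
    by (intro sum.cong refl sum.swap)
  finally show ?thesis by (simp add: path_sum_def sum_distrib_left mult.assoc)
qed

text \<open>
  With a weight that is symmetric in the pair, the swap of states is self-adjoint.
\<close>

lemma sum_swapped_pairs:
  fixes W X Y :: "'i \<Rightarrow> 'i \<Rightarrow> 'r :: comm_ring_1"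
  assumes "\<And>i j. i \<in> A \<Longrightarrow> j \<in> A \<Longrightarrow> W i j = W j i"
  shows "(\<Sum>i\<in>A. \<Sum>j\<in>A. W i j * X j i * Y i j) = (\<Sum>i\<in>A. \<Sum>j\<in>A. W i j * X i j * Y j i)"
  by (subst sum.swap) (auto intro!: sum.cong simp: assms)

text \<open>
  Primed and unprimed weights differ by an exchange of the two spectral parameters. Up to the factor \<open>\<kappa>\<close>, the operator with
  diagonal entries \<open>a\<close> and swap entries \<open>b\<close> carries unprimed to primed weights at the start, and
  primed to unprimed weights at the end. The assumption \<open>dual\<close> says that it is self-adjoint for the
  pairing that is weighted by \<open>G\<close>, so it can be moved along the path level by level.
\<close>

locale path_exchange =
  fixes S :: "nat \<Rightarrow> nat set" and N :: nat
    and G :: "nat \<Rightarrow> nat \<Rightarrow> nat \<Rightarrow> 'r :: comm_ring_1"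
    and L L' :: "nat \<Rightarrow> nat \<Rightarrow> 'r" and K K' :: "nat \<Rightarrow> nat \<Rightarrow> nat \<Rightarrow> nat \<Rightarrow> nat \<Rightarrow> 'r"
    and R R' :: "nat \<Rightarrow> nat \<Rightarrow> 'r" and a b :: "nat \<Rightarrow> nat \<Rightarrow> nat \<Rightarrow> 'r" and \<kappa> :: 'r
  assumes N: "N \<ge> 1"
    and left: "\<And>i j. i \<in> S 1 \<Longrightarrow> j \<in> S 1 \<Longrightarrow> \<kappa> * L' i j = a 1 i j * L i j + b 1 i j * L j i"
    and link: "\<And>k i j I J. 1 \<le> k \<Longrightarrow> k < N \<Longrightarrow> i \<in> S k \<Longrightarrow> j \<in> S k \<Longrightarrow> I \<in> S (Suc k) \<Longrightarrow> J \<in> S (Suc k) \<Longrightarrow>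
      a k i j * K' k i j I J + b k i j * K' k j i I J =
      a (Suc k) I J * K k i j I J + b (Suc k) I J * K k i j J I"
    and right: "\<And>i j. i \<in> S N \<Longrightarrow> j \<in> S N \<Longrightarrow> \<kappa> * R i j = a N i j * R' i j + b N i j * R' j i"
    and dual: "\<And>k i j. 1 \<le> k \<Longrightarrow> k \<le> N \<Longrightarrow> i \<in> S k \<Longrightarrow> j \<in> S k \<Longrightarrow> G k i j * b k i j = G k j i * b k j i"
begin

lemma path_sum_cong:
  assumes "k \<ge> 1" "\<And>i j. i \<in> S k \<Longrightarrow> j \<in> S k \<Longrightarrow> \<phi> i j = \<psi> i j"
  shows "path_sum S M G Q k \<phi> = path_sum S M G Q k \<psi>"
  unfolding path_sum_def
proof (intro sum.cong refl)
  fix \<alpha> \<beta> assume "\<alpha> \<in> Pi\<^sub>E {1..k} S" "\<beta> \<in> Pi\<^sub>E {1..k} S"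
  then have "\<alpha> k \<in> S k" "\<beta> k \<in> S k" using assms(1) by auto
  then show "path_wt M G Q k \<alpha> \<beta> * \<phi> (\<alpha> k) (\<beta> k) = path_wt M G Q k \<alpha> \<beta> * \<psi> (\<alpha> k) (\<beta> k)"
    by (simp add: assms(2))
qed

text \<open>
  The exchange of the spectral parameters in the first \<open>k\<close> levels amounts to letting the operator act
  on the rest of the path. In the induction step it passes from level \<open>k\<close> to level \<open>k + 1\<close> by
  \<open>link\<close>, and is then moved from the weights to \<open>\<phi>\<close> by \<open>dual\<close>.
\<close>

lemma transfer:
  assumes "1 \<le> k" "k \<le> N"
  shows "\<kappa> * path_sum S L' G K' k \<phi> = path_sum S L G K k (\<lambda>i j. a k i j * \<phi> i j + b k i j * \<phi> j i)"
  using assms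
proof (induction k arbitrary: \<phi> rule: nat_induct_at_least)
  case base
  have "\<kappa> * path_sum S L' G K' 1 \<phi> = (\<Sum>i\<in>S 1. \<Sum>j\<in>S 1. (\<kappa> * L' i j) * G 1 i j * \<phi> i j)"
    unfolding One_nat_def path_sum_1 by (simp add: sum_distrib_left mult_ac)
  also have "\<dots> = (\<Sum>i\<in>S 1. \<Sum>j\<in>S 1. L i j * G 1 i j * (a 1 i j * \<phi> i j)) +
      (\<Sum>i\<in>S 1. \<Sum>j\<in>S 1. (G 1 i j * b 1 i j) * L j i * \<phi> i j)"
    unfolding sum.distrib[symmetric]
    by (intro sum.cong refl) (simp add: left distrib_left distrib_right mult_ac)
  also have "(\<Sum>i\<in>S 1. \<Sum>j\<in>S 1. (G 1 i j * b 1 i j) * L j i * \<phi> i j) =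
      (\<Sum>i\<in>S 1. \<Sum>j\<in>S 1. (G 1 i j * b 1 i j) * L i j * \<phi> j i)"
    using dual[of 1] N by (intro sum_swapped_pairs) auto
  finally show ?case
    unfolding One_nat_def path_sum_1
    by (simp add: sum.distrib[symmetric] distrib_left mult_ac)
next
  case (Suc k)
  let ?S = "S (Suc k)"
  have k: "1 \<le> k" "k < N" using Suc by auto
  have "\<kappa> * path_sum S L' G K' (Suc k) \<phi> = path_sum S L G K k
     (\<lambda>i j. a k i j * (\<Sum>I\<in>?S. \<Sum>J\<in>?S. K' k i j I J * G (Suc k) I J * \<phi> I J) +
       b k i j * (\<Sum>I\<in>?S. \<Sum>J\<in>?S. K' k j i I J * G (Suc k) I J * \<phi> I J))"
    unfolding path_sum_Suc[OF k(1)] using Suc by (subst Suc.IH) auto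
  also have "\<dots> = path_sum S L G K k (\<lambda>i j. \<Sum>I\<in>?S. \<Sum>J\<in>?S. K k i j I J * G (Suc k) I J *
      (a (Suc k) I J * \<phi> I J + b (Suc k) I J * \<phi> J I))"
  proof (rule path_sum_cong[OF k(1)])
    fix i j assume ij: "i \<in> S k" "j \<in> S k"
    have "a k i j * (\<Sum>I\<in>?S. \<Sum>J\<in>?S. K' k i j I J * G (Suc k) I J * \<phi> I J) +
        b k i j * (\<Sum>I\<in>?S. \<Sum>J\<in>?S. K' k j i I J * G (Suc k) I J * \<phi> I J) =
      (\<Sum>I\<in>?S. \<Sum>J\<in>?S. (a k i j * K' k i j I J + b k i j * K' k j i I J) * (G (Suc k) I J * \<phi> I J))"
      by (simp add: sum_distrib_left sum.distrib distrib_right mult.assoc)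
    also have "\<dots> = (\<Sum>I\<in>?S. \<Sum>J\<in>?S. K k i j I J * G (Suc k) I J * (a (Suc k) I J * \<phi> I J)) +
        (\<Sum>I\<in>?S. \<Sum>J\<in>?S. (G (Suc k) I J * b (Suc k) I J) * K k i j J I * \<phi> I J)"
      unfolding sum.distrib[symmetric]
      by (intro sum.cong refl) (simp add: link[OF k ij] distrib_left distrib_right mult_ac)
    also have "(\<Sum>I\<in>?S. \<Sum>J\<in>?S. (G (Suc k) I J * b (Suc k) I J) * K k i j J I * \<phi> I J) =
        (\<Sum>I\<in>?S. \<Sum>J\<in>?S. (G (Suc k) I J * b (Suc k) I J) * K k i j I J * \<phi> J I)"
      using dual[of "Suc k"] k by (intro sum_swapped_pairs) auto
    finally show "a k i j * (\<Sum>I\<in>?S. \<Sum>J\<in>?S. K' k i j I J * G (Suc k) I J * \<phi> I J) +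
        b k i j * (\<Sum>I\<in>?S. \<Sum>J\<in>?S. K' k j i I J * G (Suc k) I J * \<phi> I J) =
      (\<Sum>I\<in>?S. \<Sum>J\<in>?S. K k i j I J * G (Suc k) I J * (a (Suc k) I J * \<phi> I J + b (Suc k) I J * \<phi> J I))"
      by (simp add: sum.distrib[symmetric] distrib_left mult_ac)
  qed
  finally show ?case unfolding path_sum_Suc[OF k(1)] .
qed

theorem path_sums_agree: "\<kappa> * path_sum S L' G K' N R' = \<kappa> * path_sum S L G K N R"
proof -
  have "\<kappa> * path_sum S L' G K' N R' = path_sum S L G K N (\<lambda>i j. \<kappa> * R i j)"
    unfolding transfer[OF N order_refl] by (rule path_sum_cong[OF N]) (simp add: right)
  then show ?thesis by (simp add: path_sum_def sum_distrib_left mult_ac)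
qed

end

section \<open>Symmetry of the coefficients at a generic point\<close>

text \<open>
  The case of interest is \<open>f = \<theta>\<close>. In every weight the exponential factors combine to one that is
  symmetric under \<open>i \<leftrightarrow> j\<close> and under \<open>u \<leftrightarrow> v\<close>, so all exchange relations hold for \<open>f\<close> with the same
  coefficients, formed with \<open>s\<close>.
\<close>

locale twisted_three_term = three_term +
  fixes f :: "complex \<Rightarrow> complex" and c :: complex
  assumes twist: "f z = exp (c * z) * s z"
begin

lemma left_wt_twist:
  "left_wt f h z u v i j = exp (c * (u + v - (z i + shifted_coord h z i j))) * left_wt s h z u v i j"
  unfolding left_wt_def twist by (simp add: exp_add exp_diff exp_minus algebra_simps)

lemma right_wt_twist:
  "right_wt f h z u v i j = exp (c * (u + v + (z i + shifted_coord h z i j))) * right_wt s h z u v i j"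
  unfolding right_wt_def twist by (simp add: exp_add exp_diff algebra_simps)

lemma link_wt_twist:
  "link_wt f h z Z t u v i j I J =
     exp (c * (u + v + 2 * (z i + shifted_coord h z i j) - 2 * t + h)) * link_wt s h z Z t u v i j I J"
proof -
  have "exp (c * (u + z i - Z I)) * exp (c * (z i + Z I - t)) *
      (exp (c * (v + shifted_coord h z i j - shifted_coord h Z I J)) *
       exp (c * (shifted_coord h z i j + shifted_coord h Z I J - (t - h)))) =
    exp (c * (u + v + 2 * (z i + shifted_coord h z i j) - 2 * t + h))"
    unfolding exp_add[symmetric] by (rule arg_cong[where f = exp]) (simp add: algebra_simps)
  from this[symmetric] show ?thesis
    unfolding link_wt_def twist by (simp add: mult_ac)
qed

lemma shifted_coord_sum_sym: "z j + shifted_coord h z j i = z i + shifted_coord h z i j"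
  by (simp add: shifted_coord_def)

lemma left_exchange_twist:
  assumes "i \<noteq> j \<Longrightarrow> s (z i - z j) \<noteq> 0"
  shows "s (u - v - h) * left_wt f h z v u i j =
    exch_diag s h (u - v) z i j * left_wt f h z u v i j + exch_off s h (u - v) z i j * left_wt f h z u v j i"
  using arg_cong[OF left_exchange[of i j z u v h, OF assms], of "(*) (exp (c * (u + v - (z i + shifted_coord h z i j))))"]
  unfolding left_wt_twist shifted_coord_sum_sym[of z j h i] add.commute[of v u]
  by (simp add: distrib_left mult_ac)

lemma right_exchange_twist:
  assumes "i \<noteq> j \<Longrightarrow> s (z i - z j) \<noteq> 0"
  shows "s (u - v - h) * right_wt f h z u v i j =
    exch_diag s h (u - v) z i j * right_wt f h z v u i j + exch_off s h (u - v) z i j * right_wt f h z v u j i"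
  using arg_cong[OF right_exchange[of i j z u v h, OF assms], of "(*) (exp (c * (u + v + (z i + shifted_coord h z i j))))"]
  unfolding right_wt_twist shifted_coord_sum_sym[of z j h i] add.commute[of v u]
  by (simp add: distrib_left mult_ac)

lemma link_exchange_twist:
  assumes "i \<noteq> j \<Longrightarrow> s (z i - z j) \<noteq> 0" and "I \<noteq> J \<Longrightarrow> s (Z I - Z J) \<noteq> 0"
  shows "exch_diag s h (u - v) z i j * link_wt f h z Z t v u i j I J +
      exch_off s h (u - v) z i j * link_wt f h z Z t v u j i I J =
    exch_diag s h (u - v) Z I J * link_wt f h z Z t u v i j I J +
      exch_off s h (u - v) Z I J * link_wt f h z Z t u v i j J I"
  using arg_cong[OF link_exchange[of i j z I J Z h u v t, OF assms],
      of "(*) (exp (c * (u + v + 2 * (z i + shifted_coord h z i j) - 2 * t + h)))"]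
  unfolding link_wt_twist shifted_coord_sum_sym[of z j h i] add.commute[of v u]
  by (simp add: distrib_left mult_ac)

end

text \<open>
  The part of the denominators of both factors that belongs to one level, with indices in \<open>M\<close>.
\<close>

definition site_den where
  "site_den f h M z i j = (\<Prod>\<delta>\<in>M - {i}. f (z i - z \<delta>)) *
     (\<Prod>\<delta>\<in>M - {j}. f (shifted_coord h z i j - shifted_coord h z i \<delta>))"

context twisted_three_term
begin

text \<open>
  All factors with a third index \<open>\<delta>\<close> are symmetric in \<open>i\<close> and \<open>j\<close>, because \<open>z j\<close> and \<open>z \<delta>\<close> are shifted by
  the same amount. The asymmetry is concentrated in \<open>s (z i - z j) * s (z i - z j + h)\<close>.
\<close>

lemma site_den_distinct:
  assumes "finite M" "i \<in> M" "j \<in> M" "i \<noteq> j"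
  shows "site_den f h M z i j = - exp (- (c * h)) * (s (z i - z j) * s (z i - z j + h)) *
    ((\<Prod>\<delta>\<in>M - {i, j}. f (z i - z \<delta>)) * (\<Prod>\<delta>\<in>M - {i, j}. f (z j - z \<delta>)))"
proof -
  have M: "M - {i} = insert j (M - {i, j})" "M - {j} = insert i (M - {i, j})" using assms by auto
  have 1: "(\<Prod>\<delta>\<in>M - {i}. f (z i - z \<delta>)) = f (z i - z j) * (\<Prod>\<delta>\<in>M - {i, j}. f (z i - z \<delta>))"
    unfolding M by (subst prod.insert) (use assms in auto)
  have "(\<Prod>\<delta>\<in>M - {j}. f (shifted_coord h z i j - shifted_coord h z i \<delta>)) =
      f (z j - h - z i) * (\<Prod>\<delta>\<in>M - {i, j}. f (shifted_coord h z i j - shifted_coord h z i \<delta>))"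
    unfolding M by (subst prod.insert) (use assms in \<open>auto simp: shifted_coord_def\<close>)
  also have "(\<Prod>\<delta>\<in>M - {i, j}. f (shifted_coord h z i j - shifted_coord h z i \<delta>)) =
      (\<Prod>\<delta>\<in>M - {i, j}. f (z j - z \<delta>))"
    by (intro prod.cong) (use assms in \<open>auto simp: shifted_coord_def\<close>)
  finally have 2: "(\<Prod>\<delta>\<in>M - {j}. f (shifted_coord h z i j - shifted_coord h z i \<delta>)) =
      f (z j - h - z i) * (\<Prod>\<delta>\<in>M - {i, j}. f (z j - z \<delta>))" .
  have "exp (c * (z i - z j)) * exp (c * (z j - h - z i)) = exp (- (c * h))"
    by (simp add: exp_add[symmetric] algebra_simps)
  moreover have "s (z j - h - z i) = - s (z i - z j + h)"
    using odd[of "z i - z j + h"] by (simp add: algebra_simps)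
  ultimately have ff: "f (z i - z j) * f (z j - h - z i) = - exp (- (c * h)) * (s (z i - z j) * s (z i - z j + h))"
    by (simp add: twist)
  have "site_den f h M z i j = (f (z i - z j) * f (z j - h - z i)) *
    ((\<Prod>\<delta>\<in>M - {i, j}. f (z i - z \<delta>)) * (\<Prod>\<delta>\<in>M - {i, j}. f (z j - z \<delta>)))"
    unfolding site_den_def 1 2 by (simp only: mult_ac)
  then show ?thesis unfolding ff .
qed

text \<open>
  The factor \<open>s (z i - z j + h)\<close> of the off-diagonal entry cancels the asymmetric factor of the
  denominator.
\<close>

lemma site_exch_dual:
  assumes "finite M" "i \<in> M" "j \<in> M"
    and nz: "i \<noteq> j \<Longrightarrow> s (z i - z j + h) \<noteq> 0" "i \<noteq> j \<Longrightarrow> s (z j - z i + h) \<noteq> 0"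
  shows "exch_off s h w z i j / site_den f h M z i j = exch_off s h w z j i / site_den f h M z j i"
proof (cases "i = j")
  case False
  have o: "s (z j - z i) = - s (z i - z j)" using odd[of "z i - z j"] by simp
  have sw: "M - {j, i} = M - {i, j}" by auto
  show ?thesis
    using False nz
    unfolding site_den_distinct[OF assms(1-3) False] site_den_distinct[OF assms(1,3,2) False[symmetric]]
      exch_off_def sw o
    by (simp add: mult_ac)
qed simp

end

lemma single_zero_mult_single:
  fixes c d :: "'a :: comm_ring_1"
  shows "Poly_Mapping.single 0 c * Poly_Mapping.single (m :: 'b :: comm_monoid_add) d = Poly_Mapping.single m (c * d)"
  by (simp add: mult_single)

lemma prod_single:
  "finite A \<Longrightarrow> (\<Prod>k\<in>A. Poly_Mapping.single (m k :: 'b :: comm_monoid_add) (c k)) =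
    Poly_Mapping.single (\<Sum>k\<in>A. m k) (\<Prod>k\<in>A. c k :: 'a :: comm_ring_1)"
  by (induction A rule: finite_induct) (auto simp: mult_single)

text \<open>
  The coefficient of the pair \<open>(\<alpha>, \<beta>)\<close> in the product of the elements at \<open>u\<close> and \<open>v\<close>, with \<open>N = n - 1\<close>
  levels, arranged as a weight of a pair of paths.
\<close>

definition pair_coeff where
  "pair_coeff f h p N z t u v \<alpha> \<beta> =
     left_wt f h (z 1) u v (\<alpha> 1) (\<beta> 1) *
     (\<Prod>\<gamma>=1..N. 1 / site_den f h {1..p \<gamma>} (z \<gamma>) (\<alpha> \<gamma>) (\<beta> \<gamma>)) *
     (\<Prod>\<gamma>=1..N - 1. link_wt f h (z \<gamma>) (z (\<gamma> + 1)) (t \<gamma>) u v (\<alpha> \<gamma>) (\<beta> \<gamma>) (\<alpha> (\<gamma> + 1)) (\<beta> (\<gamma> + 1))) *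
     right_wt f h (z N) u v (\<alpha> N) (\<beta> N)"

context twisted_three_term
begin

text \<open>
  The monomials \<open>\<mu>\<close> of a level are symmetric in the two paths, so they can be absorbed into the weights
  of the levels. In this way, all coefficients of the product are treated at once, as one path sum in a
  commutative monoid algebra over the complex numbers.
\<close>

lemma pair_sum_symmetric_generic:
  fixes \<mu> :: "nat \<Rightarrow> nat \<Rightarrow> 'b :: comm_monoid_add" and z :: "nat \<Rightarrow> nat \<Rightarrow> complex"
  assumes N: "N \<ge> 1" and \<kappa>: "s (u - v - h) \<noteq> 0"
    and nz: "\<And>\<gamma> i j. \<gamma> \<in> {1..N} \<Longrightarrow> i \<in> {1..p \<gamma>} \<Longrightarrow> j \<in> {1..p \<gamma>} \<Longrightarrow> i \<noteq> j \<Longrightarrow>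
      s (z \<gamma> i - z \<gamma> j) \<noteq> 0 \<and> s (z \<gamma> i - z \<gamma> j + h) \<noteq> 0"
  defines "A \<equiv> \<Pi>\<^sub>E \<gamma>\<in>{1..N}. {1..p \<gamma>}"
  shows "(\<Sum>\<alpha>\<in>A. \<Sum>\<beta>\<in>A. Poly_Mapping.single (\<Sum>\<gamma>=1..N. \<mu> \<gamma> (\<alpha> \<gamma>) + \<mu> \<gamma> (\<beta> \<gamma>)) (pair_coeff f h p N z t u v \<alpha> \<beta>)) =
    (\<Sum>\<alpha>\<in>A. \<Sum>\<beta>\<in>A. Poly_Mapping.single (\<Sum>\<gamma>=1..N. \<mu> \<gamma> (\<alpha> \<gamma>) + \<mu> \<gamma> (\<beta> \<gamma>)) (pair_coeff f h p N z t v u \<alpha> \<beta>))"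
    (is "?T u v = ?T v u")
proof -
  define \<iota> :: "complex \<Rightarrow> 'b \<Rightarrow>\<^sub>0 complex" where "\<iota> = Poly_Mapping.single 0"
  have \<iota>: "\<iota> (x * y) = \<iota> x * \<iota> y" "\<iota> (x + y) = \<iota> x + \<iota> y" for x y
    by (simp_all add: \<iota>_def mult_single single_add)
  define G where "G \<gamma> i j = Poly_Mapping.single (\<mu> \<gamma> i + \<mu> \<gamma> j) (1 / site_den f h {1..p \<gamma>} (z \<gamma>) i j)" for \<gamma> i j
  define L where "L u v i j = \<iota> (left_wt f h (z 1) u v i j)" for u v i j
  define R where "R u v i j = \<iota> (right_wt f h (z N) u v i j)" for u v i j
  define K where "K u v \<gamma> i j I J = \<iota> (link_wt f h (z \<gamma>) (z (\<gamma> + 1)) (t \<gamma>) u v i j I J)" for u v \<gamma> i j I J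
  define a where "a \<gamma> i j = \<iota> (exch_diag s h (u - v) (z \<gamma>) i j)" for \<gamma> i j
  define b where "b \<gamma> i j = \<iota> (exch_off s h (u - v) (z \<gamma>) i j)" for \<gamma> i j
  interpret path_exchange "\<lambda>\<gamma>. {1..p \<gamma>}" N G "L u v" "L v u" "K u v" "K v u" "R u v" "R v u" a b "\<iota> (s (u - v - h))"
  proof
    fix i j assume "i \<in> {1..p 1}" "j \<in> {1..p 1}"
    then show "\<iota> (s (u - v - h)) * L v u i j = a 1 i j * L u v i j + b 1 i j * L u v j i"
      unfolding L_def a_def b_def \<iota>[symmetric]
      by (subst left_exchange_twist) (use nz[of 1 i j] N in auto)
  next
    fix k i j I J assume *: "1 \<le> k" "k < N" "i \<in> {1..p k}" "j \<in> {1..p k}" "I \<in> {1..p (Suc k)}" "J \<in> {1..p (Suc k)}"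
    then show "a k i j * K v u k i j I J + b k i j * K v u k j i I J =
      a (Suc k) I J * K u v k i j I J + b (Suc k) I J * K u v k i j J I"
      unfolding K_def a_def b_def \<iota>[symmetric] Suc_eq_plus1
      by (subst link_exchange_twist) (use nz[of k i j] nz[of "Suc k" I J] in auto)
  next
    fix i j assume "i \<in> {1..p N}" "j \<in> {1..p N}"
    then show "\<iota> (s (u - v - h)) * R u v i j = a N i j * R v u i j + b N i j * R v u j i"
      unfolding R_def a_def b_def \<iota>[symmetric]
      by (subst right_exchange_twist) (use nz[of N i j] N in auto)
  next
    fix k i j assume "1 \<le> k" "k \<le> N" "i \<in> {1..p k}" "j \<in> {1..p k}"
    then show "G k i j * b k i j = G k j i * b k j i"
      using site_exch_dual[of "{1..p k}" i j "z k" h "u - v"] nz[of k i j] nz[of k j i]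
      unfolding G_def b_def \<iota>_def mult.commute[of _ "Poly_Mapping.single 0 _"] single_zero_mult_single
      by (auto simp: add.commute)
  qed (rule N)
  have T: "?T u v = path_sum (\<lambda>\<gamma>. {1..p \<gamma>}) (L u v) G (K u v) N (R u v)" for u v
  proof -
    have "path_wt (L u v) G (K u v) N \<alpha> \<beta> * R u v (\<alpha> N) (\<beta> N) =
      Poly_Mapping.single (\<Sum>\<gamma>=1..N. \<mu> \<gamma> (\<alpha> \<gamma>) + \<mu> \<gamma> (\<beta> \<gamma>)) (pair_coeff f h p N z t u v \<alpha> \<beta>)" for \<alpha> \<beta>
      unfolding path_wt_def pair_coeff_def L_def R_def K_def G_def \<iota>_def
      by (simp add: prod_single mult_single)
    then show ?thesis unfolding path_sum_def A_def by simp
  qed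
  have "\<iota> (s (u - v - h)) * ?T v u = \<iota> (s (u - v - h)) * ?T u v"
    unfolding T by (rule path_sums_agree)
  then have "\<iota> (1 / s (u - v - h)) * \<iota> (s (u - v - h)) * ?T v u =
      \<iota> (1 / s (u - v - h)) * \<iota> (s (u - v - h)) * ?T u v"
    by (simp only: mult.assoc)
  then show ?thesis using \<kappa> by (simp add: \<iota>(1)[symmetric]) (simp add: \<iota>_def single_one)
qed

text \<open>
  Both sides are continuous in \<open>u\<close>, and the excluded values are the translates of the zeros of \<open>s\<close>.
\<close>

lemma pair_sum_symmetric:
  fixes \<mu> :: "nat \<Rightarrow> nat \<Rightarrow> 'b :: comm_monoid_add" and z :: "nat \<Rightarrow> nat \<Rightarrow> complex"
  assumes cont: "continuous_on UNIV s" and dense: "dense_set {w. s w \<noteq> 0}" and N: "N \<ge> 1"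
    and nz: "\<And>\<gamma> i j. \<gamma> \<in> {1..N} \<Longrightarrow> i \<in> {1..p \<gamma>} \<Longrightarrow> j \<in> {1..p \<gamma>} \<Longrightarrow> i \<noteq> j \<Longrightarrow>
      s (z \<gamma> i - z \<gamma> j) \<noteq> 0 \<and> s (z \<gamma> i - z \<gamma> j + h) \<noteq> 0"
  defines "A \<equiv> \<Pi>\<^sub>E \<gamma>\<in>{1..N}. {1..p \<gamma>}"
  shows "(\<Sum>\<alpha>\<in>A. \<Sum>\<beta>\<in>A. Poly_Mapping.single (\<Sum>\<gamma>=1..N. \<mu> \<gamma> (\<alpha> \<gamma>) + \<mu> \<gamma> (\<beta> \<gamma>)) (pair_coeff f h p N z t u v \<alpha> \<beta>)) =
    (\<Sum>\<alpha>\<in>A. \<Sum>\<beta>\<in>A. Poly_Mapping.single (\<Sum>\<gamma>=1..N. \<mu> \<gamma> (\<alpha> \<gamma>) + \<mu> \<gamma> (\<beta> \<gamma>)) (pair_coeff f h p N z t v u \<alpha> \<beta>))"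
    (is "?T u v = ?T v u")
proof (rule poly_mapping_eqI)
  fix m
  define D where "D u = Poly_Mapping.lookup (?T u v) m - Poly_Mapping.lookup (?T v u) m" for u
  have f: "continuous_on UNIV f"
    unfolding twist[abs_def] by (intro continuous_intros cont)
  have cf: "continuous_on UNIV (\<lambda>u. f (g u))" if "continuous_on UNIV g" for g :: "complex \<Rightarrow> complex"
    using continuous_on_compose2[OF f that] by simp
  have ls: "Poly_Mapping.lookup (Poly_Mapping.single k x) m = x * of_bool (k = m)" for k and x :: complex
    by (simp add: lookup_single when_def)
  have "continuous_on UNIV D"
    unfolding D_def lookup_sum ls pair_coeff_def left_wt_def right_wt_def link_wt_def
    by (intro continuous_intros cf)
  \<comment> \<open>In terms of \<open>w = u - v - h\<close> the excluded values are the zeros of \<open>s\<close>.\<close>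
  then have contD: "continuous_on UNIV (\<lambda>w. D (w + (v + h)))"
    by (rule continuous_on_compose2) (auto intro!: continuous_intros)
  have zero: "D (w + (v + h)) = 0" if "s w \<noteq> 0" for w
    unfolding D_def A_def by (subst pair_sum_symmetric_generic[OF N _ nz]) (use that in auto)
  have "open {w. D (w + (v + h)) \<noteq> 0}"
    by (intro open_Collect_neq contD continuous_on_const)
  then have "{w. D (w + (v + h)) \<noteq> 0} = {}"
    using dense zero unfolding dense_set_iff by fastforce
  then have "D (u - (v + h) + (v + h)) = 0" by blast
  then show "Poly_Mapping.lookup (?T u v) m = Poly_Mapping.lookup (?T v u) m" by (simp add: D_def)
qed

end

section \<open>Commutativity of the elements\<close>

lemma gfun_of_eqI:
  assumes "open D" "dense_set D" "\<And>x. x \<in> D \<Longrightarrow> f x = g x"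
  shows "gfun_of f = gfun_of g"
  using assms by transfer (auto simp: generic_eq_def)

lemma gfun_of_0: "gfun_of (\<lambda>_. 0) = 0"
  by transfer (rule generic_eq_refl)

lemma gfun_of_add: "gfun_of (\<lambda>x. f x + g x) = gfun_of f + gfun_of g"
  by transfer (rule generic_eq_refl)

lemma gfun_of_sum: "gfun_of (\<lambda>x. \<Sum>i\<in>I. f i x) = (\<Sum>i\<in>I. gfun_of (f i))"
  by (induction I rule: infinite_finite_induct) (simp_all add: gfun_of_0 gfun_of_add)

lemma gfun_of_mult_translate:
  "gfun_of f * translate c (gfun_of g) = gfun_of (\<lambda>x. f x * g (\<lambda>i. x i - c i))"
  by transfer (rule generic_eq_refl)

lemma lookup_sum_single_gfun_of:
  "Poly_Mapping.lookup (\<Sum>i\<in>I. Poly_Mapping.single (m i) (gfun_of (f i))) k =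
    gfun_of (\<lambda>x. Poly_Mapping.lookup (\<Sum>i\<in>I. Poly_Mapping.single (m i) (f i x)) k)"
  unfolding lookup_sum gfun_of_sum by (intro sum.cong) (auto simp: lookup_single when_def gfun_of_0)

text \<open>
  An identity between polynomials at every point of a dense open set is an identity between
  polynomials whose coefficients are functions up to generic equality.
\<close>

lemma sum_single_gfun_of_eqI:
  assumes "open D" "dense_set D"
    and "\<And>x. x \<in> D \<Longrightarrow> (\<Sum>i\<in>I. Poly_Mapping.single (m i) (f i x)) = (\<Sum>i\<in>I. Poly_Mapping.single (m i) (g i x))"
  shows "(\<Sum>i\<in>I. Poly_Mapping.single (m i) (gfun_of (f i))) = (\<Sum>i\<in>I. Poly_Mapping.single (m i) (gfun_of (g i)))"
  by (rule poly_mapping_eqI) (auto simp: lookup_sum_single_gfun_of assms(3) intro!: gfun_of_eqI[OF assms(1,2)])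

lemma lookup_Tmono:
  "Poly_Mapping.lookup (Tmono n \<alpha>) (egen a \<gamma>) = (if \<gamma> \<in> {1..n-1} \<and> \<alpha> \<gamma> = a then 1 else 0)"
  "Poly_Mapping.lookup (Tmono n \<alpha>) (fgen \<gamma>) = (if \<gamma> \<in> {1..n-2} then 1 else 0)"
proof -
  have "(\<Sum>\<delta>=1..n-1. Poly_Mapping.lookup (Poly_Mapping.single (egen (\<alpha> \<delta>) \<delta>) (1::nat)) (egen a \<gamma>)) =
      (\<Sum>\<delta>=1..n-1. if \<gamma> = \<delta> then (if \<alpha> \<gamma> = a then 1 else 0) else 0)"
    by (intro sum.cong) (auto simp: lookup_single when_def)
  then show "Poly_Mapping.lookup (Tmono n \<alpha>) (egen a \<gamma>) = (if \<gamma> \<in> {1..n-1} \<and> \<alpha> \<gamma> = a then 1 else 0)"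
    unfolding Tmono_def lookup_add lookup_sum by (simp add: lookup_single when_def)
  have "(\<Sum>\<delta>=1..n-2. Poly_Mapping.lookup (Poly_Mapping.single (fgen \<delta>) (1::nat)) (fgen \<gamma>)) =
      (\<Sum>\<delta>=1..n-2. if \<gamma> = \<delta> then 1 else 0)"
    by (intro sum.cong) (auto simp: lookup_single when_def)
  then show "Poly_Mapping.lookup (Tmono n \<alpha>) (fgen \<gamma>) = (if \<gamma> \<in> {1..n-2} then 1 else 0)"
    unfolding Tmono_def lookup_add lookup_sum by (simp add: lookup_single when_def)
qed

lemma shift_Tmono_zvar:
  assumes "\<alpha> \<in> (\<Pi>\<^sub>E \<gamma>\<in>{1..n-1}. {1..p \<gamma>})" "\<gamma> \<in> {1..n-1}"
  shows "x (zvar b \<gamma>) - shift n p \<eta> (Tmono n \<alpha>) (zvar b \<gamma>) =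
    shifted_coord (of_nat n * \<eta>) (\<lambda>i. x (zvar i \<gamma>)) (\<alpha> \<gamma>) b"
proof -
  have "\<alpha> \<gamma> \<in> {1..p \<gamma>}" using assms by auto
  then have "(\<Sum>a\<in>{1..p \<gamma>} - {b}. Poly_Mapping.lookup (Tmono n \<alpha>) (egen a \<gamma>)) = (if b = \<alpha> \<gamma> then 0 else 1)"
    using assms(2) by (simp add: lookup_Tmono)
  then show ?thesis by (simp only: shift.simps shifted_coord_def) simp
qed

lemma shift_Tmono_tvar:
  assumes "\<gamma> \<in> {1..n-2}"
  shows "shift n p \<eta> (Tmono n \<alpha>) (tvar \<gamma>) = of_nat n * \<eta>"
  using assms by (simp add: lookup_Tmono)

lemma coefficient_product:
  fixes x :: "var \<Rightarrow> complex" and \<eta> :: complex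
  assumes n: "n \<ge> 2" and \<alpha>: "\<alpha> \<in> (\<Pi>\<^sub>E \<gamma>\<in>{1..n-1}. {1..p \<gamma>})"
  defines "x' \<equiv> \<lambda>i. x i - shift n p \<eta> (Tmono n \<alpha>) i"
  shows "(Tnum n \<theta> u \<alpha> x / Tden n p \<theta> \<alpha> x * Ttail n \<theta> \<alpha> x) *
      (Tnum n \<theta> v \<beta> x' / Tden n p \<theta> \<beta> x' * Ttail n \<theta> \<beta> x') =
    pair_coeff \<theta> (of_nat n * \<eta>) p (n - 1) (\<lambda>\<gamma> i. x (zvar i \<gamma>)) (\<lambda>\<gamma>. x (tvar \<gamma>)) u v \<alpha> \<beta>"
proof -
  define h where "h = of_nat n * \<eta>"
  define z where "z = (\<lambda>\<gamma> i. x (zvar i \<gamma>))"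
  define y where "y = (\<lambda>\<gamma>. shifted_coord h (z \<gamma>) (\<alpha> \<gamma>))"
  have x': "x' (zvar b \<gamma>) = y \<gamma> b" if "\<gamma> \<in> {1..n-1}" for b \<gamma>
    unfolding x'_def y_def z_def h_def by (rule shift_Tmono_zvar[OF \<alpha> that])
  have t': "x' (tvar \<gamma>) = x (tvar \<gamma>) - h" if "\<gamma> \<in> {1..n-2}" for \<gamma>
    unfolding x'_def h_def using shift_Tmono_tvar[OF that] by simp
  have num: "Tnum n \<theta> v \<beta> x' = \<theta> (v - y 1 (\<beta> 1)) *
      (\<Prod>\<gamma>=1..n-2. \<theta> (v + y \<gamma> (\<beta> \<gamma>) - y (\<gamma> + 1) (\<beta> (\<gamma> + 1)))) * \<theta> (v + y (n - 1) (\<beta> (n - 1)))"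
  proof -
    have "(\<Prod>\<gamma>=1..n-2. \<theta> (v + x' (zvar (\<beta> \<gamma>) \<gamma>) - x' (zvar (\<beta> (\<gamma> + 1)) (\<gamma> + 1)))) =
      (\<Prod>\<gamma>=1..n-2. \<theta> (v + y \<gamma> (\<beta> \<gamma>) - y (\<gamma> + 1) (\<beta> (\<gamma> + 1))))"
      by (intro prod.cong refl arg_cong[where f = \<theta>]) (auto simp: x')
    then show ?thesis unfolding Tnum_def using n by (simp add: x')
  qed
  have den: "Tden n p \<theta> \<beta> x' = (\<Prod>\<gamma>=1..n-1. \<Prod>\<delta>\<in>{1..p \<gamma>} - {\<beta> \<gamma>}. \<theta> (y \<gamma> (\<beta> \<gamma>) - y \<gamma> \<delta>))"
    unfolding Tden_def by (intro prod.cong refl) (simp only: x')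
  have tail: "Ttail n \<theta> \<beta> x' = (\<Prod>\<gamma>=1..n-2. \<theta> (y \<gamma> (\<beta> \<gamma>) + y (\<gamma> + 1) (\<beta> (\<gamma> + 1)) - (x (tvar \<gamma>) - h)))"
    unfolding Ttail_def
    by (intro prod.cong refl arg_cong[where f = \<theta>]) (auto simp: x' t')
  have n2: "n - 1 - 1 = n - 2" by simp
  show ?thesis
    unfolding num den tail Tnum_def[of _ _ u] Tden_def[of _ _ _ \<alpha>] Ttail_def[of _ _ \<alpha>]
      pair_coeff_def left_wt_def right_wt_def link_wt_def site_den_def n2
      h_def[symmetric] z_def[symmetric]
    unfolding y_def[symmetric, THEN fun_cong] prod_dividef prod.distrib
    by (simp add: y_def z_def mult_ac)
qed

text \<open>
  The generator \<open>f\<^bsub>\<gamma>,\<gamma>+1\<^esub>\<close> is attributed to level \<open>\<gamma>\<close>; the last level has none.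
\<close>

lemma Tmono_add:
  assumes "n \<ge> 2"
  shows "Tmono n \<alpha> + Tmono n \<beta> = (\<Sum>\<gamma>=1..n-1.
     (Poly_Mapping.single (egen (\<alpha> \<gamma>) \<gamma>) 1 + (if \<gamma> \<le> n - 2 then Poly_Mapping.single (fgen \<gamma>) 1 else 0)) +
     (Poly_Mapping.single (egen (\<beta> \<gamma>) \<gamma>) 1 + (if \<gamma> \<le> n - 2 then Poly_Mapping.single (fgen \<gamma>) 1 else 0)))"
proof -
  have "(\<Sum>\<gamma>=1..n-1. if \<gamma> \<le> n - 2 then Poly_Mapping.single (fgen \<gamma>) (1 :: nat) else 0) =
      (\<Sum>\<gamma>=1..n-2. Poly_Mapping.single (fgen \<gamma>) 1)"
    by (rule sum.mono_neutral_cong_right) auto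
  then show ?thesis unfolding Tmono_def sum.distrib by (simp add: add_ac)
qed

lemma dense_set_entire_nz:
  assumes "\<theta> holomorphic_on UNIV" "\<theta> w0 \<noteq> 0"
  shows "dense_set {w. \<theta> w \<noteq> 0}"
  unfolding dense_set_iff
proof (intro allI impI notI)
  fix U :: "complex set" assume U: "open U" "U \<noteq> {}" "U \<inter> {w. \<theta> w \<noteq> 0} = {}"
  have "\<theta> w0 = 0"
    by (rule analytic_continuation_open[where s = U and s' = UNIV and g = "\<lambda>_. 0"])
       (use U assms in auto)
  then show False using assms(2) by simp
qed

text \<open>
  The conditions exclude the poles of both products as well as the zeros of the factors by which the
  exchange relations are divided.
\<close>

lemma generic_points:
  assumes hol: "\<theta> holomorphic_on UNIV" and w0: "\<theta> w0 \<noteq> 0"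
  obtains D where "open D" "dense_set D"
    "\<And>x \<gamma> i j. x \<in> D \<Longrightarrow> \<gamma> \<in> {1..n-1} \<Longrightarrow> i \<in> {1..p \<gamma>} \<Longrightarrow> j \<in> {1..p \<gamma>} \<Longrightarrow> i \<noteq> j \<Longrightarrow>
      \<theta> (x (zvar i \<gamma>) - x (zvar j \<gamma>)) \<noteq> 0 \<and> \<theta> (x (zvar i \<gamma>) - x (zvar j \<gamma>) + h) \<noteq> 0"
proof -
  define J where "J = (SIGMA \<gamma>:{1..n-1}. {(i, j). i \<in> {1..p \<gamma>} \<and> j \<in> {1..p \<gamma>} \<and> i \<noteq> j}) \<times> {0, h}"
  \<comment> \<open>The last component \<open>a\<close> of an index is \<open>0\<close> for the first condition and \<open>h\<close> for the second one.\<close>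
  define F where "F = (\<lambda>((\<gamma>, i, j), a) x. \<theta> (x (zvar i \<gamma>) - x (zvar j \<gamma>) + a))"
  have "finite {(i, j). i \<in> {1..p \<gamma>} \<and> j \<in> {1..p \<gamma>} \<and> i \<noteq> j}" for \<gamma>
    by (rule finite_subset[of _ "{1..p \<gamma>} \<times> {1..p \<gamma>}"]) auto
  then have fin: "finite J" unfolding J_def by auto
  have holF: "holomorphic_multi UNIV (F k)" for k
    unfolding F_def case_prod_unfold
    by (intro holomorphic_multi_compose[OF hol] holomorphic_multi_add holomorphic_multi_diff
        holomorphic_multi_coord holomorphic_multi_const)
  have dense: "dense_set {x. F k x \<noteq> 0}" if "k \<in> J" for k
  proof -
    obtain \<gamma> i j a where k: "k = ((\<gamma>, i, j), a)" by (metis surj_pair)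
    then have "i \<noteq> j" using that by (simp add: J_def)
    have "\<theta> (w0 - a + a) \<noteq> 0" using w0 by simp
    from dense_set_theta_nz[OF entire_translate[OF hol] this, of "zvar i \<gamma>" "zvar j \<gamma>"] k \<open>i \<noteq> j\<close>
    show ?thesis by (simp add: F_def)
  qed
  show ?thesis
  proof (rule that[of "{x. (\<Prod>k\<in>J. F k x) \<noteq> 0}"])
    show "open {x. (\<Prod>k\<in>J. F k x) \<noteq> 0}"
      by (intro open_nz holomorphic_multi_prod holF)
    show "dense_set {x. (\<Prod>k\<in>J. F k x) \<noteq> 0}"
      by (intro dense_set_prod_nz fin holF dense)
    fix x \<gamma> i j assume x: "x \<in> {x. (\<Prod>k\<in>J. F k x) \<noteq> 0}"
      and ij: "\<gamma> \<in> {1..n-1}" "i \<in> {1..p \<gamma>}" "j \<in> {1..p \<gamma>}" "i \<noteq> j"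
    have "F k x \<noteq> 0" if "k \<in> J" for k using x fin that by auto
    from this[of "((\<gamma>, i, j), 0)"] this[of "((\<gamma>, i, j), h)"]
    show "\<theta> (x (zvar i \<gamma>) - x (zvar j \<gamma>)) \<noteq> 0 \<and> \<theta> (x (zvar i \<gamma>) - x (zvar j \<gamma>) + h) \<noteq> 0"
      using ij by (simp add: J_def F_def)
  qed
qed

lemma Bmult_Ttilde:
  assumes "n \<ge> 2"
  shows "Bmult n p \<eta> (Ttilde n p \<theta> u) (Ttilde n p \<theta> v) =
    (\<Sum>(\<alpha>, \<beta>)\<in>(\<Pi>\<^sub>E \<gamma>\<in>{1..n-1}. {1..p \<gamma>}) \<times> (\<Pi>\<^sub>E \<gamma>\<in>{1..n-1}. {1..p \<gamma>}).
      Poly_Mapping.single (Tmono n \<alpha> + Tmono n \<beta>) (gfun_of (\<lambda>x.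
        pair_coeff \<theta> (of_nat n * \<eta>) p (n - 1) (\<lambda>\<gamma> i. x (zvar i \<gamma>)) (\<lambda>\<gamma>. x (tvar \<gamma>)) u v \<alpha> \<beta>)))"
  unfolding Ttilde_def Bmult_sum_left Bmult_sum_right Bmult_single gfun_of_mult_translate
    sum.cartesian_product[symmetric]
  by (subst sum.swap, intro sum.cong refl arg_cong2[where f = Poly_Mapping.single] arg_cong[where f = gfun_of] ext
      coefficient_product assms)

lemma Ttilde_commute:
  assumes th: "theta_order1 \<tau> \<theta>" and n: "n \<ge> 2"
  shows "Bmult n p \<eta> (Ttilde n p \<theta> u) (Ttilde n p \<theta> v) = Bmult n p \<eta> (Ttilde n p \<theta> v) (Ttilde n p \<theta> u)"
proof -
  have hol: "\<theta> holomorphic_on UNIV" using th by (simp add: theta_order1_def)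
  obtain w0 where w0: "\<theta> w0 \<noteq> 0" using th by (auto simp: theta_order1_def)
  interpret three_term "odd_theta \<theta>" by (rule three_term_odd_theta[OF th])
  interpret twisted_three_term "odd_theta \<theta>" \<theta> "of_real pi * \<i>"
    by unfold_locales (rule theta_eq_odd_theta)
  have nz: "odd_theta \<theta> w \<noteq> 0 \<longleftrightarrow> \<theta> w \<noteq> 0" for w by (simp add: odd_theta_def)
  have cont: "continuous_on UNIV (odd_theta \<theta>)"
    unfolding odd_theta_def[abs_def]
    by (intro continuous_intros holomorphic_on_imp_continuous_on[OF hol])
  have dense: "dense_set {w. odd_theta \<theta> w \<noteq> 0}"
    unfolding nz by (rule dense_set_entire_nz[OF hol w0])
  obtain D where D: "open D" "dense_set D"
    "\<And>x \<gamma> i j. x \<in> D \<Longrightarrow> \<gamma> \<in> {1..n-1} \<Longrightarrow> i \<in> {1..p \<gamma>} \<Longrightarrow> j \<in> {1..p \<gamma>} \<Longrightarrow> i \<noteq> j \<Longrightarrow>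
      \<theta> (x (zvar i \<gamma>) - x (zvar j \<gamma>)) \<noteq> 0 \<and> \<theta> (x (zvar i \<gamma>) - x (zvar j \<gamma>) + of_nat n * \<eta>) \<noteq> 0"
    by (rule generic_points[OF hol w0, where n = n and p = p and h = "of_nat n * \<eta>"]) blast
  have N: "n - 1 \<ge> 1" using n by simp
  show ?thesis
    unfolding Bmult_Ttilde[OF n] case_prod_unfold
  proof (rule sum_single_gfun_of_eqI[OF D(1,2)])
    fix x assume "x \<in> D"
    show "(\<Sum>ab\<in>(\<Pi>\<^sub>E \<gamma>\<in>{1..n-1}. {1..p \<gamma>}) \<times> (\<Pi>\<^sub>E \<gamma>\<in>{1..n-1}. {1..p \<gamma>}).
        Poly_Mapping.single (Tmono n (fst ab) + Tmono n (snd ab))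
          (pair_coeff \<theta> (of_nat n * \<eta>) p (n - 1) (\<lambda>\<gamma> i. x (zvar i \<gamma>)) (\<lambda>\<gamma>. x (tvar \<gamma>)) u v (fst ab) (snd ab))) =
      (\<Sum>ab\<in>(\<Pi>\<^sub>E \<gamma>\<in>{1..n-1}. {1..p \<gamma>}) \<times> (\<Pi>\<^sub>E \<gamma>\<in>{1..n-1}. {1..p \<gamma>}).
        Poly_Mapping.single (Tmono n (fst ab) + Tmono n (snd ab))
          (pair_coeff \<theta> (of_nat n * \<eta>) p (n - 1) (\<lambda>\<gamma> i. x (zvar i \<gamma>)) (\<lambda>\<gamma>. x (tvar \<gamma>)) v u (fst ab) (snd ab)))"
      unfolding Tmono_add[OF n]
      by (rule pair_sum_symmetric[OF cont dense N, unfolded sum.cartesian_product case_prod_unfold nz])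
        (use D(3)[OF \<open>x \<in> D\<close>] in blast)
  qed
qed

theorem proposition3p3:
  fixes \<tau> \<eta> :: complex and \<theta> :: "complex \<Rightarrow> complex" and n :: nat and p :: "nat \<Rightarrow> nat"
  assumes "Im \<tau> > 0" and "theta_order1 \<tau> \<theta>"
    and "n \<ge> 2" and "\<And>\<gamma>. \<gamma> \<in> {1..n - 1} \<Longrightarrow> p \<gamma> \<ge> 1"
  shows "\<forall>u v. commutator (Btilde n p \<eta>) (Ttilde n p \<theta> u) (Ttilde n p \<theta> v) = \<zero>\<^bsub>Btilde n p \<eta>\<^esub>"
proof (intro allI)
  fix u v
  interpret ring "Btilde n p \<eta>" by (rule ring_Btilde)
  have "Ttilde n p \<theta> w \<in> carrier (Btilde n p \<eta>)" for w
    by (rule Ttilde_carrier[OF assms(2,3)])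
  then have "Ttilde n p \<theta> v \<otimes>\<^bsub>Btilde n p \<eta>\<^esub> Ttilde n p \<theta> u \<in> carrier (Btilde n p \<eta>)"
    by (intro m_closed)
  moreover have "Ttilde n p \<theta> u \<otimes>\<^bsub>Btilde n p \<eta>\<^esub> Ttilde n p \<theta> v = Ttilde n p \<theta> v \<otimes>\<^bsub>Btilde n p \<eta>\<^esub> Ttilde n p \<theta> u"
    by (simp only: Btilde_sel Ttilde_commute[OF assms(2,3), of p \<eta> u v])
  ultimately show "commutator (Btilde n p \<eta>) (Ttilde n p \<theta> u) (Ttilde n p \<theta> v) = \<zero>\<^bsub>Btilde n p \<eta>\<^esub>"
    unfolding commutator_def a_minus_def by (simp only: r_neg)
qed

end
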